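(* Let $\Gamma$ be a finitely presented amenable group. Then for any sequence $(\Gamma_n)$ of pairwise distinct finite index subgroups of $\Gamma$, the rank gradient exists and $$\mathrm{RG}(\Gamma,(\Gamma_n))=0.$$
   Context: For a finitely generated group $H$ let $d(H)$ be its minimal number of generators. For an (infinite) sequence $(\Gamma_n)$ of finite index subgroups of $\Gamma$, not necessarily a chain, $\mathrm{RG}(\Gamma,(\Gamma_n))=\lim_{n\to\infty}\frac{d(\Gamma_n)-1}{|\Gamma:\Gamma_n|}$ when this limit exists. *)

theory Defs
  imports Complex_Main "HOL-Algebra.Algebra"
begin

section \<open>Free groups and finite presentations\<close>

text \<open>
  A letter is a pair \<open>(x, e)\<close>, standing for the generator \<open>x\<close> if \<open>e\<close> holds and for its formal
  inverse otherwise. The free group on \<open>S\<close> is realised on the freely reduced words over \<open>S\<close>.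
\<close>

definition inv_letter :: "'x \<times> bool \<Rightarrow> 'x \<times> bool" where
  "inv_letter a = (fst a, \<not> snd a)"

definition reduced :: "('x \<times> bool) list \<Rightarrow> bool" where
  "reduced w \<longleftrightarrow> successively (\<lambda>a b. b \<noteq> inv_letter a) w"

fun cons_letter :: "'x \<times> bool \<Rightarrow> ('x \<times> bool) list \<Rightarrow> ('x \<times> bool) list" where
  "cons_letter a [] = [a]"
| "cons_letter a (b # w) = (if b = inv_letter a then w else a # b # w)"

definition free_group :: "'x set \<Rightarrow> ('x \<times> bool) list monoid" where
  "free_group S =
     \<lparr>carrier = {w. reduced w \<and> fst ` set w \<subseteq> S}, monoid.mult = foldr cons_letter, one = []\<rparr>"

definition normal_closure :: "('a, 'b) monoid_scheme \<Rightarrow> 'a set \<Rightarrow> 'a set" where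
  "normal_closure G R =
     generate G {g \<otimes>\<^bsub>G\<^esub> r \<otimes>\<^bsub>G\<^esub> inv\<^bsub>G\<^esub> g | g r. g \<in> carrier G \<and> r \<in> R}"

text \<open>Up to renaming, a finite set of generators is an initial segment of the natural numbers.\<close>

definition finitely_presented :: "('a, 'b) monoid_scheme \<Rightarrow> bool" where
  "finitely_presented G \<longleftrightarrow>
     (\<exists>(n::nat) R. finite R \<and> R \<subseteq> carrier (free_group {..<n}) \<and>
        G \<cong> free_group {..<n} Mod normal_closure (free_group {..<n}) R)"

lemma inv_letter_inv_letter [simp]: "inv_letter (inv_letter a) = a"
  by (simp add: inv_letter_def)

lemma fst_inv_letter [simp]: "fst (inv_letter a) = fst a"
  by (simp add: inv_letter_def)

lemma reduced_Nil [simp]: "reduced []"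
  by (simp add: reduced_def)

lemma reduced_tl: "reduced (a # w) \<Longrightarrow> reduced w"
  by (cases w) (auto simp: reduced_def)

lemma reduced_cons_letter: "reduced w \<Longrightarrow> reduced (cons_letter a w)"
  by (cases w) (auto simp: reduced_def dest: reduced_tl[unfolded reduced_def])

lemma cons_letter_cancel:
  "reduced w \<Longrightarrow> cons_letter a (cons_letter (inv_letter a) w) = w"
proof (cases w)
  case (Cons b v)
  then show "reduced w \<Longrightarrow> ?thesis"
    by (cases v) (auto simp: reduced_def)
qed simp

lemma cons_letter_cancel':
  "reduced w \<Longrightarrow> cons_letter (inv_letter a) (cons_letter a w) = w"
  using cons_letter_cancel[of w "inv_letter a"] by simp

lemma reduced_foldr: "reduced w \<Longrightarrow> reduced (foldr cons_letter u w)"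
  by (induction u) (auto intro: reduced_cons_letter)

lemma set_cons_letter: "set (cons_letter a w) \<subseteq> insert a (set w)"
  by (cases w) auto

lemma set_foldr: "set (foldr cons_letter u w) \<subseteq> set u \<union> set w"
  by (induction u) (use set_cons_letter in fastforce)+

lemma foldr_cons_letter:
  "reduced w \<Longrightarrow> foldr cons_letter (cons_letter a u) w = cons_letter a (foldr cons_letter u w)"
  by (cases u) (auto simp: cons_letter_cancel reduced_foldr)

lemma foldr_assoc:
  "reduced w \<Longrightarrow>
    foldr cons_letter (foldr cons_letter u v) w = foldr cons_letter u (foldr cons_letter v w)"
  by (induction u) (auto simp: foldr_cons_letter)

lemma foldr_Nil: "reduced w \<Longrightarrow> foldr cons_letter w [] = w"
proof (induction w)
  case (Cons a w)
  then show ?case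
    by (cases w) (auto simp: reduced_def)
qed simp

lemma foldr_inv: "reduced w \<Longrightarrow> foldr cons_letter (rev (map inv_letter u)) (foldr cons_letter u w) = w"
  by (induction u) (auto simp: cons_letter_cancel' reduced_foldr)

lemma group_free_group: "group (free_group S)"
proof (rule groupI)
  fix u assume u: "u \<in> carrier (free_group S)"
  define v where "v = foldr cons_letter (rev (map inv_letter u)) []"
  have "set v \<subseteq> inv_letter ` set u"
    using set_foldr[of "rev (map inv_letter u)" "[]"] by (auto simp: v_def)
  then have "fst ` set v \<subseteq> fst ` set u"
    by (metis (no_types, lifting) fst_inv_letter image_cong image_image image_mono)
  also have "\<dots> \<subseteq> S"
    using u by (simp add: free_group_def)
  finally have "fst ` set v \<subseteq> S" .
  then have "v \<in> carrier (free_group S)"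
    by (simp add: free_group_def v_def reduced_foldr)
  moreover have "v \<otimes>\<^bsub>free_group S\<^esub> u = \<one>\<^bsub>free_group S\<^esub>"
  proof -
    have ru: "reduced u"
      using u by (simp add: free_group_def)
    have "foldr cons_letter v u = foldr cons_letter (rev (map inv_letter u)) (foldr cons_letter u [])"
      using foldr_assoc[OF ru, of "rev (map inv_letter u)" "[]"] foldr_Nil[OF ru]
      by (simp add: v_def)
    then show ?thesis
      using foldr_inv[of "[]" u] by (simp add: free_group_def)
  qed
  ultimately show "\<exists>v\<in>carrier (free_group S). v \<otimes>\<^bsub>free_group S\<^esub> u = \<one>\<^bsub>free_group S\<^esub>"
    by blast
qed (use set_foldr in \<open>fastforce simp: free_group_def reduced_foldr foldr_assoc foldr_Nil\<close>)+

lemma (in group) normal_normal_closure: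
  assumes "R \<subseteq> carrier G"
  shows "normal_closure G R \<lhd> G"
  unfolding normal_closure_def
proof (rule normal_generateI)
  fix h g
  assume h: "h \<in> {g \<otimes> r \<otimes> inv g | g r. g \<in> carrier G \<and> r \<in> R}" and g: "g \<in> carrier G"
  then obtain k r where kr: "h = k \<otimes> r \<otimes> inv k" "k \<in> carrier G" "r \<in> R"
    by blast
  then have "g \<otimes> h \<otimes> inv g = (g \<otimes> k) \<otimes> r \<otimes> inv (g \<otimes> k)"
    using g assms by (auto simp: m_assoc inv_mult_group subset_iff)
  then show "g \<otimes> h \<otimes> inv g \<in> {g \<otimes> r \<otimes> inv g | g r. g \<in> carrier G \<and> r \<in> R}"
    using kr g by blast
qed (use assms in auto)


section \<open>Amenability\<close>

text \<open>
  A discrete group is amenable if it carries a finitely additive, left-invariant probability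
  measure defined on all of its subsets. Only the values of \<open>\<mu>\<close> on subsets of the carrier matter.
\<close>

definition amenable :: "('a, 'b) monoid_scheme \<Rightarrow> bool" where
  "amenable G \<longleftrightarrow>
     (\<exists>\<mu> :: 'a set \<Rightarrow> real.
        (\<forall>A \<subseteq> carrier G. 0 \<le> \<mu> A) \<and>
        \<mu> (carrier G) = 1 \<and>
        (\<forall>A B. A \<subseteq> carrier G \<longrightarrow> B \<subseteq> carrier G \<longrightarrow> A \<inter> B = {} \<longrightarrow> \<mu> (A \<union> B) = \<mu> A + \<mu> B) \<and>
        (\<forall>g \<in> carrier G. \<forall>A \<subseteq> carrier G. \<mu> (g <#\<^bsub>G\<^esub> A) = \<mu> A))"


section \<open>Rank gradient\<close>

text \<open>
  The minimal number of generators. It is meaningful only for finitely generated groups; these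
  include all finite index subgroups of a finitely presented group.
\<close>

definition min_generators :: "('a, 'b) monoid_scheme \<Rightarrow> nat" where
  "min_generators G =
     (LEAST n. \<exists>S. S \<subseteq> carrier G \<and> finite S \<and> card S = n \<and> generate G S = carrier G)"

text \<open>The subtraction is carried out in the reals, since the trivial group has no generators.\<close>

definition rank_gradient_seq ::
  "('a, 'b) monoid_scheme \<Rightarrow> (nat \<Rightarrow> 'a set) \<Rightarrow> nat \<Rightarrow> real" where
  "rank_gradient_seq G H n =
     (real (min_generators (G\<lparr>carrier := H n\<rparr>)) - 1) / real (card (rcosets\<^bsub>G\<^esub> H n))"

definition rank_gradient :: "('a, 'b) monoid_scheme \<Rightarrow> (nat \<Rightarrow> 'a set) \<Rightarrow> real" where
  "rank_gradient G H = lim (rank_gradient_seq G H)"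

end

(*
  Choose a finite symmetric generating set S whose Cayley graph becomes simply connected when all
  triangles are filled. By amenability the Schreier graphs of G on the cosets of finite index
  subgroups H can be cut, uniformly in H, into pieces of bounded size by removing few edges. Lift
  such a decomposition to the Cayley graph of G, on which H acts. Simple connectivity makes the
  components of the lift the vertices of a tree-like structure: the edges between a component v and
  one branch of its complement are connected via triangles, so that the stabiliser of a branch is
  generated by few elements. The invariant mean of a branch is at most 1/3 if the branch has at least
  three translates under the stabiliser of v, and there is at most one component all of whose
  branches are that small. If it exists, it is fixed by H, and the rank of H is bounded. Otherwise
  every component has a branch with at most two translates, so that the stabiliser of the component
  needs few generators, and together with one element for each removed edge these stabilisers
  generate H. Since G has only finitely many subgroups of a given index, this suffices.
*)
theory Submission
  imports Defs "HOL-Library.Disjoint_Sets"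
begin

section \<open>Presentations and simple connectivity\<close>

text \<open>No chain condition is available, so the limit has to come from a bound d(H) \<le> C +
  \<epsilon> |G:H| with C independent of \<open>H\<close>. The obstacle is that counting vertices
  gains nothing: there may be about |G:H|/K pieces of size K, a lifted piece may be infinite, and
  bounding the rank of its stabiliser by the number of its vertices modulo \<open>H\<close> costs of
  order K generators, so that the sum is again proportional to |G:H|. The ranks have to be charged
  to the removed edges. For this the stabiliser acts freely on the edges into one branch; a free
  action on a connected graph bounds the rank by the number of orbits, and finite presentation is
  what makes this graph of edges connected. Only vanishing of the first cohomology mod 2 of the
  triangle complex is needed there, so simple connectivity is stated through
  \<open>bool\<close>-valued cocycles, without complexes or homotopies. Amenability enters twice:
  through Foelner sets, and through the mean of subsets of the group itself, which limits the number
  of disjoint translates of a branch.\<close>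

context group
begin

text \<open>Edges join \<open>x\<close> to \<open>x \<otimes> s\<close>, so that left translations
  are automorphisms and a subgroup \<open>H\<close> acts from the left, with the right cosets
  \<open>H #> x\<close> as its orbits.\<close>

definition adj :: "'a set \<Rightarrow> 'a \<Rightarrow> 'a \<Rightarrow> bool" where
  "adj S x y \<longleftrightarrow> x \<in> carrier G \<and> y \<in> carrier G \<and> inv x \<otimes> y \<in> S"

text \<open>The flag complex of the Cayley graph has no first cohomology with coefficients in \<open>\<int>/2\<close>.\<close>

definition simply_connected :: "'a set \<Rightarrow> bool" where
  "simply_connected S \<longleftrightarrow>
     (\<forall>c. (\<forall>x y z. adj S x y \<longrightarrow> adj S y z \<longrightarrow> adj S x z \<longrightarrow> c x z = (c x y \<noteq> c y z)) \<longrightarrow>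
        (\<exists>\<phi> :: 'a \<Rightarrow> bool. \<forall>x y. adj S x y \<longrightarrow> c x y = (\<phi> x \<noteq> \<phi> y)))"

primrec word_val :: "('x \<Rightarrow> 'a) \<Rightarrow> 'x list \<Rightarrow> 'a" where
  "word_val t [] = \<one>"
| "word_val t (a # w) = t a \<otimes> word_val t w"

text \<open>The integral of the cochain \<open>c\<close> along the path that starts at
  \<open>x\<close> and reads the letters of the word; \<open>bool\<close> with
  \<open>\<noteq>\<close> as addition stands for the integers mod 2.\<close>

primrec path_sum :: "('a \<Rightarrow> 'a \<Rightarrow> bool) \<Rightarrow> ('x \<Rightarrow> 'a) \<Rightarrow> 'a \<Rightarrow> 'x list \<Rightarrow> bool" where
  "path_sum c t x [] = False"
| "path_sum c t x (a # w) = (c x (x \<otimes> t a) \<noteq> path_sum c t (x \<otimes> t a) w)"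

lemma word_val_closed [simp]: "t ` set w \<subseteq> carrier G \<Longrightarrow> word_val t w \<in> carrier G"
  by (induction w) auto

lemma word_val_append:
  "t ` set u \<subseteq> carrier G \<Longrightarrow> t ` set v \<subseteq> carrier G \<Longrightarrow>
    word_val t (u @ v) = word_val t u \<otimes> word_val t v"
  by (induction u) (auto simp: m_assoc)

lemma path_sum_append:
  "t ` set u \<subseteq> carrier G \<Longrightarrow> t ` set v \<subseteq> carrier G \<Longrightarrow> x \<in> carrier G \<Longrightarrow>
    path_sum c t x (u @ v) = (path_sum c t x u \<noteq> path_sum c t (x \<otimes> word_val t u) v)"
  by (induction u arbitrary: x) (auto simp: m_assoc)

lemma word_val_inv:
  assumes "t ` set w \<subseteq> carrier G" "\<And>a. a \<in> set w \<Longrightarrow> t (inv_letter a) = inv (t a)"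
  shows "word_val t (rev (map inv_letter w)) = inv (word_val t w)"
  using assms
proof (induction w)
  case (Cons a w)
  have "word_val t (rev (map inv_letter w) @ [inv_letter a])
      = word_val t (rev (map inv_letter w)) \<otimes> word_val t [inv_letter a]"
    by (rule word_val_append) (use Cons.prems in \<open>auto intro!: inv_closed\<close>)
  then show ?case
    using Cons by (simp add: inv_mult_group)
qed simp

lemma adj_sym:
  assumes "S \<subseteq> carrier G" "\<And>s. s \<in> S \<Longrightarrow> inv s \<in> S" "adj S x y"
  shows "adj S y x"
proof -
  have "inv (inv x \<otimes> y) = inv y \<otimes> x"
    using assms by (simp add: adj_def inv_mult_group)
  then show ?thesis
    using assms by (metis adj_def)
qed

lemma inv_mult_cancel [simp]:
  "x \<in> carrier G \<Longrightarrow> y \<in> carrier G \<Longrightarrow> inv x \<otimes> (x \<otimes> y) = y"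
  "x \<in> carrier G \<Longrightarrow> y \<in> carrier G \<Longrightarrow> x \<otimes> (inv x \<otimes> y) = y"
  by (simp_all add: m_assoc[symmetric])

lemma adj_mult_left:
  "h \<in> carrier G \<Longrightarrow> adj S x y \<Longrightarrow> adj S (h \<otimes> x) (h \<otimes> y)"
  by (simp add: adj_def inv_mult_group m_assoc)

lemma adj_mult_right:
  "S \<subseteq> carrier G \<Longrightarrow> x \<in> carrier G \<Longrightarrow> s \<in> S \<Longrightarrow> adj S x (x \<otimes> s)"
  by (auto simp: adj_def subset_iff)

lemma presentation:
  assumes "finitely_presented G"
  obtains n :: nat and R \<theta> where "finite R" "R \<subseteq> carrier (free_group {..<n})"
    "\<theta> \<in> hom (free_group {..<n}) G" "\<theta> ` carrier (free_group {..<n}) = carrier G"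
    "\<And>w. w \<in> carrier (free_group {..<n}) \<Longrightarrow> \<theta> w = \<one> \<Longrightarrow>
      w \<in> normal_closure (free_group {..<n}) R"
    "\<And>w. w \<in> R \<Longrightarrow> \<theta> w = \<one>"
proof -
  obtain n :: nat and R where R: "finite R" "R \<subseteq> carrier (free_group {..<n})"
    and iso: "G \<cong> free_group {..<n} Mod normal_closure (free_group {..<n}) R"
    using assms unfolding finitely_presented_def by blast
  define F where "F = free_group {..<n}"
  define N where "N = normal_closure F R"
  interpret F: group F
    unfolding F_def by (rule group_free_group)
  interpret N: normal N F
    unfolding N_def using R by (intro F.normal_normal_closure) (simp add: F_def)
  interpret FN: group "F Mod N"
    by (rule N.factorgroup_is_group)
  have "F Mod N \<cong> G"
    using iso iso_sym F_def N_def by blast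
  then obtain k where k: "k \<in> iso (F Mod N) G"
    by (auto simp: is_iso_def)
  interpret k: group_hom "F Mod N" G k
    using k by unfold_locales (auto simp: iso_def)
  define \<theta> where "\<theta> w = k (N #>\<^bsub>F\<^esub> w)" for w
  have "(\<lambda>w. N #>\<^bsub>F\<^esub> w) \<in> hom F (F Mod N)"
    by (rule N.r_coset_hom_Mod)
  then have hom: "\<theta> \<in> hom F G"
    using Group.hom_compose[OF _ k.homh, of "\<lambda>w. N #>\<^bsub>F\<^esub> w" F]
    by (simp add: \<theta>_def[abs_def] comp_def)
  have car: "carrier (F Mod N) = (\<lambda>w. N #>\<^bsub>F\<^esub> w) ` carrier F"
    by (auto simp: FactGroup_def RCOSETS_def)
  have surj: "\<theta> ` carrier F = carrier G"
    using k car by (auto simp: iso_def bij_betw_def \<theta>_def image_image)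
  have ker: "\<theta> w = \<one> \<longleftrightarrow> w \<in> N" if w: "w \<in> carrier F" for w
  proof -
    have "N #>\<^bsub>F\<^esub> w \<in> carrier (F Mod N)"
      using w car by blast
    moreover have "inj_on k (carrier (F Mod N))"
      using k by (simp add: iso_def bij_betw_def)
    ultimately have "k (N #>\<^bsub>F\<^esub> w) = k \<one>\<^bsub>F Mod N\<^esub> \<longleftrightarrow> N #>\<^bsub>F\<^esub> w = \<one>\<^bsub>F Mod N\<^esub>"
      using FN.one_closed by (metis inj_on_eq_iff)
    then have "\<theta> w = \<one> \<longleftrightarrow> N #>\<^bsub>F\<^esub> w = \<one>\<^bsub>F Mod N\<^esub>"
      using k.hom_one by (simp add: \<theta>_def)
    also have "\<dots> \<longleftrightarrow> w \<in> N"
      using w F.coset_join1[OF _ w N.subgroup_axioms] F.coset_join2[OF w N.subgroup_axioms]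
      by auto
    finally show ?thesis .
  qed
  have "R \<subseteq> N"
  proof
    fix r assume r: "r \<in> R"
    then have "\<one>\<^bsub>F\<^esub> \<otimes>\<^bsub>F\<^esub> r \<otimes>\<^bsub>F\<^esub> inv\<^bsub>F\<^esub> \<one>\<^bsub>F\<^esub> = r"
      using R by (auto simp: F_def[symmetric])
    then show "r \<in> N"
      unfolding N_def normal_closure_def using r by (intro generate.incl) force
  qed
  then have "\<theta> w = \<one>" if "w \<in> R" for w
    using that ker R by (auto simp: F_def[symmetric])
  then show thesis
    using that[of R n \<theta>] R hom surj ker unfolding F_def N_def by blast
qed


text \<open>\<open>generate\<close> is closed under arbitrary products, whereas walks in the graph
  grow by one generator on the right. Generalising over the starting point \<open>x\<close> makes
  the product case a concatenation of two walks.\<close>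

lemma generate_right_induct:
  assumes "S \<subseteq> carrier G" "\<And>s. s \<in> S \<Longrightarrow> inv s \<in> S"
    and "g \<in> generate G S" "x \<in> carrier G" "P x"
    and step: "\<And>y s. y \<in> carrier G \<Longrightarrow> s \<in> S \<Longrightarrow> P y \<Longrightarrow> P (y \<otimes> s)"
  shows "P (x \<otimes> g)"
  using assms(3-5)
proof (induction g arbitrary: x)
  case (eng g h)
  have c: "g \<in> carrier G" "h \<in> carrier G"
    using eng.hyps assms(1) by (simp_all add: generate_in_carrier)
  then have "P (x \<otimes> g \<otimes> h)"
    using eng by simp
  then show ?case
    using eng.prems c by (simp add: m_assoc)
qed (use assms in auto)

lemma word_val_hom:
  assumes "\<theta> \<in> hom (free_group Y) G" "w \<in> carrier (free_group Y)"
  shows "word_val (\<lambda>a. \<theta> [a]) w = \<theta> w"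
  using assms(2)
proof (induction w)
  case Nil
  then show ?case
    using hom_one[OF assms(1) group_free_group is_group] by (simp add: free_group_def)
next
  case (Cons a w)
  then have w: "w \<in> carrier (free_group Y)" and a: "[a] \<in> carrier (free_group Y)"
    by (auto simp: free_group_def dest: reduced_tl) (simp add: reduced_def)
  have "cons_letter a w = a # w"
    using Cons.prems by (cases w) (auto simp: free_group_def reduced_def)
  then have "[a] \<otimes>\<^bsub>free_group Y\<^esub> w = a # w"
    by (simp add: free_group_def)
  then show ?case
    using Cons.IH[OF w] hom_mult[OF assms(1) a w] by simp
qed

text \<open>A cancelled pair of letters traverses an edge back and forth; its two contributions
  agree by symmetry of \<open>c\<close> and vanish mod 2.\<close>

lemma path_sum_reduce:
  assumes tc: "\<And>a. fst a \<in> Y \<Longrightarrow> t a \<in> carrier G"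
    and ti: "\<And>a. fst a \<in> Y \<Longrightarrow> t (inv_letter a) = inv (t a)"
    and sym: "\<And>x a. x \<in> carrier G \<Longrightarrow> fst a \<in> Y \<Longrightarrow> c (x \<otimes> t a) x = c x (x \<otimes> t a)"
    and "fst ` set u \<subseteq> Y" "fst ` set w \<subseteq> Y" "x \<in> carrier G"
  shows "path_sum c t x (foldr cons_letter u w) = path_sum c t x (u @ w)"
  using assms(4-)
proof (induction u arbitrary: x)
  case (Cons a u)
  have *: "path_sum c t x (cons_letter a v) = path_sum c t x (a # v)" if "fst ` set v \<subseteq> Y" for v
  proof (cases v)
    case (Cons b v')
    show ?thesis
    proof (cases "b = inv_letter a")
      case True
      have a: "fst a \<in> Y" "t a \<in> carrier G"
        using \<open>fst ` set (a # u) \<subseteq> Y\<close> tc by auto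
      then have "path_sum c t x (a # v) = (c x (x \<otimes> t a) \<noteq> (c (x \<otimes> t a) x \<noteq> path_sum c t x v'))"
        using \<open>x \<in> carrier G\<close> by (simp add: Cons True ti m_assoc)
      moreover have "cons_letter a v = v'"
        by (simp add: Cons True)
      ultimately show ?thesis
        using sym[OF \<open>x \<in> carrier G\<close> a(1)] by argo
    qed (simp add: Cons)
  qed simp
  have "fst ` set (foldr cons_letter u w) \<subseteq> Y"
    using image_mono[OF set_foldr[of u w], of fst] Cons.prems by (simp add: image_Un) blast
  from *[OF this] show ?case
    using Cons.IH[of "x \<otimes> t a"] Cons.prems tc by simp
qed simp

text \<open>With the values of all words up to the length of the longest relator in
  \<open>S\<close>, every relator loop bounds a fan of triangles. A cocycle then sums to zero around
  all relations, and its potential at \<open>x\<close> is the sum along any word with value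
  \<open>x\<close>.\<close>

lemma simply_connected_presentation:
  assumes "finitely_presented G"
  obtains S where "finite S" "S \<subseteq> carrier G" "\<one> \<in> S" "\<And>s. s \<in> S \<Longrightarrow> inv s \<in> S"
    "generate G S = carrier G" "simply_connected S"
proof -
  obtain n :: nat and R \<theta> where pres: "finite R" "R \<subseteq> carrier (free_group {..<n})"
    "\<theta> \<in> hom (free_group {..<n}) G" "\<theta> ` carrier (free_group {..<n}) = carrier G"
    and ker: "\<And>w. w \<in> carrier (free_group {..<n}) \<Longrightarrow> \<theta> w = \<one> \<Longrightarrow>
      w \<in> normal_closure (free_group {..<n}) R"
    and R1: "\<And>w. w \<in> R \<Longrightarrow> \<theta> w = \<one>"
    by (rule presentation[OF assms]) (rule that)
  define F where "F = free_group {..<n}"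
  interpret F: group F
    unfolding F_def by (rule group_free_group)
  interpret \<theta>: group_hom F G \<theta>
    using pres by unfold_locales (simp add: F_def)
  define t where "t a = \<theta> [a]" for a
  define words where "words = {w :: (nat \<times> bool) list. fst ` set w \<subseteq> {..<n}}"
  have letter: "[a] \<in> carrier F" if "fst a < n" for a
    using that by (simp add: F_def free_group_def reduced_def)
  have tc: "t a \<in> carrier G" if "fst a < n" for a
    using letter[OF that] by (simp add: t_def)
  have ti: "t (inv_letter a) = inv (t a)" if "fst a < n" for a
  proof -
    have "[inv_letter a] \<otimes>\<^bsub>F\<^esub> [a] = \<one>\<^bsub>F\<^esub>"
      by (simp add: F_def free_group_def)
    then have "t (inv_letter a) \<otimes> t a = \<one>"
      using that letter letter[of "inv_letter a"] by (metis \<theta>.hom_mult \<theta>.hom_one fst_inv_letter t_def)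
    then show ?thesis
      using that tc tc[of "inv_letter a"] by (simp add: inv_equality)
  qed
  have tsub: "t ` set w \<subseteq> carrier G" if "w \<in> words" for w
    using that tc by (auto simp: words_def)
  have val: "word_val t w = \<theta> w" if "w \<in> carrier F" for w
    using word_val_hom[of \<theta> "{..<n}" w] that pres by (simp add: t_def[abs_def] F_def)
  have carF: "carrier F \<subseteq> words"
    by (auto simp: F_def free_group_def words_def)
  \<comment> \<open>\<open>Suc\<close> makes \<open>L\<close> at least 1, so that the values of
    single letters lie in \<open>S\<close>; inserting 0 covers an empty set of relators.\<close>
  define L where "L = Suc (Max (insert 0 (length ` R)))"
  have L: "length r \<le> L" if "r \<in> R" for r
    using that pres(1) by (auto simp: L_def intro!: le_SucI Max_ge)
  define S where "S = word_val t ` {w \<in> words. length w \<le> L}"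
  have "finite {w \<in> words. length w \<le> L}"
    using finite_lists_length_le[of "{..<n} \<times> (UNIV :: bool set)" L]
    by (rule rev_finite_subset) (auto simp: words_def image_subset_iff)
  then have "finite S"
    by (simp add: S_def)
  moreover have Sc: "S \<subseteq> carrier G"
    using tsub by (auto simp: S_def)
  moreover have S1: "\<one> \<in> S"
    unfolding S_def by (rule image_eqI[of _ _ "[]"]) (auto simp: words_def)
  moreover have Si: "inv s \<in> S" if s: "s \<in> S" for s
  proof -
    obtain w where w: "w \<in> words" "length w \<le> L" "s = word_val t w"
      using s by (auto simp: S_def)
    have "inv s = word_val t (rev (map inv_letter w))"
      using w tsub ti by (subst word_val_inv) (auto simp: words_def)
    moreover have "rev (map inv_letter w) \<in> words"
      using w by (auto simp: words_def)
    ultimately show ?thesis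
      using w by (auto simp: S_def)
  qed
  moreover have "generate G S = carrier G"
  proof
    show "generate G S \<subseteq> carrier G"
      using Sc generate_in_carrier by blast
    have "word_val t w \<in> generate G S" if "w \<in> words" for w
      using that
    proof (induction w)
      case (Cons a w)
      have "word_val t [a] \<in> S"
        unfolding S_def using Cons.prems by (intro imageI) (auto simp: words_def L_def)
      then have "t a \<in> S"
        using Cons.prems tc by (simp add: words_def)
      then show ?case
        using Cons by (auto intro: generate.incl generate.eng simp: words_def)
    qed (auto intro: generate.one)
    then have "\<theta> w \<in> generate G S" if "w \<in> carrier F" for w
      using that val carF by (metis subsetD)
    then show "carrier G \<subseteq> generate G S"
      unfolding pres(4)[symmetric] F_def by blast
  qed
  moreover have "simply_connected S"
    unfolding simply_connected_def
  proof (intro allI impI)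
    fix c :: "'a \<Rightarrow> 'a \<Rightarrow> bool"
    assume "\<forall>x y z. adj S x y \<longrightarrow> adj S y z \<longrightarrow> adj S x z \<longrightarrow> c x z = (c x y \<noteq> c y z)"
    then have tri: "c x z = (c x y \<noteq> c y z)" if "adj S x y" "adj S y z" "adj S x z" for x y z
      using that by blast
    have refl: "adj S x x" if "x \<in> carrier G" for x
      using that S1 by (simp add: adj_def)
    have c_refl: "\<not> c x x" if "x \<in> carrier G" for x
      using tri[of x x x] refl that by blast
    have c_sym: "c y x = c x y" if "adj S x y" for x y
      using tri[of x y x] adj_sym[OF Sc Si that] that refl[of x] c_refl[of x] by (auto simp: adj_def)
    have adj_val: "adj S x (x \<otimes> word_val t w)" if "x \<in> carrier G" "w \<in> words" "length w \<le> L" for x w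
      using that Sc by (intro adj_mult_right) (auto simp: S_def)
    have adj_t: "adj S x (x \<otimes> t a)" if "x \<in> carrier G" "fst a < n" for x a
      using adj_val[of x "[a]"] that by (simp add: words_def tc L_def)
    \<comment> \<open>A fan with apex \<open>x\<close>: each prefix of \<open>w\<close> has length
      at most \<open>L\<close>, so the chord from \<open>x\<close> to its end is an edge, and the
      next letter closes a triangle.\<close>
    have short: "path_sum c t x w = c x (x \<otimes> word_val t w)"
      if "x \<in> carrier G" "w \<in> words" "length w \<le> L" for x w
      using that(2,3)
    proof (induction w rule: rev_induct)
      case Nil
      then show ?case
        using c_refl that by simp
    next
      case (snoc a w)
      then have w: "w \<in> words" "length w \<le> L" "fst a < n"
        by (auto simp: words_def)
      note vc = word_val_closed[OF tsub[OF w(1)]]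
      have eq: "word_val t (w @ [a]) = word_val t w \<otimes> t a"
        using w tsub tc by (simp add: word_val_append)
      have "path_sum c t x (w @ [a])
          = (c x (x \<otimes> word_val t w) \<noteq> c (x \<otimes> word_val t w) (x \<otimes> word_val t w \<otimes> t a))"
        using snoc.IH w tsub tc that(1) by (simp add: path_sum_append)
      also have "\<dots> = c x (x \<otimes> word_val t w \<otimes> t a)"
        using tri[of x "x \<otimes> word_val t w" "x \<otimes> word_val t w \<otimes> t a"] vc
          adj_val[OF that(1) w(1,2)] adj_t[of "x \<otimes> word_val t w" a] adj_val[OF that(1) snoc.prems]
          w that(1) eq tc by (simp add: m_assoc)
      finally show ?case
        using eq vc w tc that(1) by (simp add: m_assoc)
    qed
    have reduce: "path_sum c t x (u \<otimes>\<^bsub>F\<^esub> w) = path_sum c t x (u @ w)"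
      if "x \<in> carrier G" "u \<in> carrier F" "w \<in> carrier F" for x u w
    proof -
      have "path_sum c t x (foldr cons_letter u w) = path_sum c t x (u @ w)"
        using that carF tc ti c_sym adj_t
        by (intro path_sum_reduce[where Y = "{..<n}"]) (auto simp: words_def)
      then show ?thesis
        by (simp add: F_def free_group_def)
    qed
    have mult: "path_sum c t x (u \<otimes>\<^bsub>F\<^esub> w) = (path_sum c t x u \<noteq> path_sum c t (x \<otimes> \<theta> u) w)"
      if "x \<in> carrier G" "u \<in> carrier F" "w \<in> carrier F" for x u w
      using that path_sum_append[of t u w x c, OF tsub tsub] carF by (simp add: reduce val subset_iff)
    have path_one: "\<not> path_sum c t x \<one>\<^bsub>F\<^esub>" for x
      by (simp add: F_def free_group_def)
    \<comment> \<open>Relations around which \<open>c\<close> sums to zero from every base point.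
      Their value is \<open>\<one>\<close>, so concatenated loops start at the same point and
      \<open>K\<close> is a subgroup; conjugating a relator only adds a path and its return.\<close>
    define K where "K = {w \<in> carrier F. \<theta> w = \<one> \<and> (\<forall>x \<in> carrier G. \<not> path_sum c t x w)}"
    have "subgroup K F"
    proof (rule F.subgroupI)
      show "K \<noteq> {}"
      proof -
        from path_one have "\<one>\<^bsub>F\<^esub> \<in> K"
          by (simp add: K_def)
        then show ?thesis
          by blast
      qed
      fix u assume u: "u \<in> K"
      have "path_sum c t x (u \<otimes>\<^bsub>F\<^esub> inv\<^bsub>F\<^esub> u) = path_sum c t x (inv\<^bsub>F\<^esub> u)" if "x \<in> carrier G" for x
        using u that by (subst mult) (auto simp: K_def)
      then show "inv\<^bsub>F\<^esub> u \<in> K"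
        using u path_one by (auto simp: K_def)
      fix v assume "v \<in> K"
      then show "u \<otimes>\<^bsub>F\<^esub> v \<in> K"
        using u by (auto simp: K_def mult)
    qed (auto simp: K_def)
    moreover have "{g \<otimes>\<^bsub>F\<^esub> r \<otimes>\<^bsub>F\<^esub> inv\<^bsub>F\<^esub> g | g r. g \<in> carrier F \<and> r \<in> R} \<subseteq> K"
    proof clarsimp
      fix g r assume g: "g \<in> carrier F" and r: "r \<in> R"
      then have rF: "r \<in> carrier F"
        using pres(2) by (auto simp: F_def)
      have "\<theta> (g \<otimes>\<^bsub>F\<^esub> r \<otimes>\<^bsub>F\<^esub> inv\<^bsub>F\<^esub> g) = \<one>"
        using g rF R1[OF r] by simp
      moreover have "\<not> path_sum c t x (g \<otimes>\<^bsub>F\<^esub> r \<otimes>\<^bsub>F\<^esub> inv\<^bsub>F\<^esub> g)" if x: "x \<in> carrier G" for x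
      proof -
        have "\<not> path_sum c t y r" if "y \<in> carrier G" for y
          using short[of y r] that rF carF L[OF r] val[OF rF] R1[OF r] c_refl by auto
        then have "path_sum c t x (g \<otimes>\<^bsub>F\<^esub> r \<otimes>\<^bsub>F\<^esub> inv\<^bsub>F\<^esub> g) = path_sum c t x (g \<otimes>\<^bsub>F\<^esub> inv\<^bsub>F\<^esub> g)"
          using g rF x R1[OF r] mult[of x g "inv\<^bsub>F\<^esub> g"] by (simp add: mult)
        then show ?thesis
          using g path_one by simp
      qed
      ultimately show "g \<otimes>\<^bsub>F\<^esub> r \<otimes>\<^bsub>F\<^esub> inv\<^bsub>F\<^esub> g \<in> K"
        using g rF by (simp add: K_def)
    qed
    ultimately have "normal_closure F R \<subseteq> K"
      unfolding normal_closure_def using F.generate_subgroup_incl by blast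
    then have kerK: "w \<in> K" if "w \<in> carrier F" "\<theta> w = \<one>" for w
      using ker that by (auto simp: F_def)
    have wd: "path_sum c t \<one> u = path_sum c t \<one> w"
      if "u \<in> carrier F" "w \<in> carrier F" "\<theta> u = \<theta> w" for u w
    proof -
      have "inv\<^bsub>F\<^esub> u \<otimes>\<^bsub>F\<^esub> w \<in> K"
        using that by (intro kerK) auto
      then have "path_sum c t \<one> (u \<otimes>\<^bsub>F\<^esub> (inv\<^bsub>F\<^esub> u \<otimes>\<^bsub>F\<^esub> w)) = path_sum c t \<one> u"
        using that by (subst mult) (auto simp: K_def)
      then show ?thesis
        using that by (simp add: F.inv_solve_left F.m_assoc[symmetric])
    qed
    \<comment> \<open>A chosen word with value \<open>x\<close>. By \<open>wd\<close> the choice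
      does not affect the sum along it, which serves as the potential at \<open>x\<close>.\<close>
    define sec where "sec x = (SOME w. w \<in> carrier F \<and> \<theta> w = x)" for x
    have sec: "sec x \<in> carrier F" "\<theta> (sec x) = x" if "x \<in> carrier G" for x
    proof -
      have "\<exists>w. w \<in> carrier F \<and> \<theta> w = x"
        using pres(4) that by (force simp: F_def)
      then have "sec x \<in> carrier F \<and> \<theta> (sec x) = x"
        unfolding sec_def by (rule someI_ex)
      then show "sec x \<in> carrier F" "\<theta> (sec x) = x"
        by auto
    qed
    show "\<exists>\<phi> :: 'a \<Rightarrow> bool. \<forall>x y. adj S x y \<longrightarrow> c x y = (\<phi> x \<noteq> \<phi> y)"
    proof (intro exI allI impI)
      fix x y assume "adj S x y"
      then have xy: "x \<in> carrier G" "y \<in> carrier G" "inv x \<otimes> y \<in> S"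
        by (auto simp: adj_def)
      then obtain u where u: "u \<in> words" "length u \<le> L" "inv x \<otimes> y = word_val t u"
        by (auto simp: S_def)
      have y: "y = x \<otimes> word_val t u"
        using xy u by (metis inv_mult_cancel(2))
      \<comment> \<open>The word \<open>u\<close> need not be reduced, so it may lie outside
        \<open>F\<close>; its free reduction has the same value and the same sum.\<close>
      let ?r = "foldr cons_letter u []"
      have rF: "?r \<in> carrier F"
        using u(1) set_foldr[of u "[]"] by (fastforce simp: F_def free_group_def reduced_foldr words_def)
      have path_r: "path_sum c t z ?r = path_sum c t z u" if "z \<in> carrier G" for z
        using path_sum_reduce[of "{..<n}" t c u "[]" z] tc ti c_sym adj_t u that by (auto simp: words_def)
      have "foldr cons_letter u [] \<in> carrier F \<and> \<theta> (foldr cons_letter u []) = word_val t u"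
        if "u \<in> words" for u
        using that
      proof (induction u)
        case Nil
        then show ?case
          using \<theta>.hom_one by (simp add: F_def free_group_def)
      next
        case (Cons a u)
        then have "fst a < n" and u: "foldr cons_letter u [] \<in> carrier F"
          "\<theta> (foldr cons_letter u []) = word_val t u"
          by (auto simp: words_def)
        moreover have "foldr cons_letter (a # u) [] = [a] \<otimes>\<^bsub>F\<^esub> foldr cons_letter u []"
          by (simp add: F_def free_group_def)
        ultimately show ?case
          using letter by (simp add: t_def[of a])
      qed
      then have "\<theta> ?r = word_val t u"
        using u by blast
      then have "\<theta> (sec x \<otimes>\<^bsub>F\<^esub> ?r) = \<theta> (sec y)"
        using sec xy y rF by simp
      then have "path_sum c t \<one> (sec y) = path_sum c t \<one> (sec x \<otimes>\<^bsub>F\<^esub> ?r)"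
        using sec xy rF by (intro wd) auto
      also have "\<dots> = (path_sum c t \<one> (sec x) \<noteq> c x y)"
        using sec xy rF path_r[of x] short[OF xy(1) u(1,2)] y by (simp add: mult)
      finally show "c x y = (path_sum c t \<one> (sec x) \<noteq> path_sum c t \<one> (sec y))"
        by blast
    qed
  qed
  ultimately show thesis
    using that by blast
qed

end

section \<open>Amenability and Foelner sets\<close>

text \<open>
  Rado's argument: a minimal subfamily satisfying Hall's condition consists of singletons.
  Minimal families are complements of maximal sets of removed pairs.
\<close>

lemma hall_infinite:
  fixes A :: "'i \<Rightarrow> 'b set"
  assumes fin: "\<And>i. i \<in> I \<Longrightarrow> finite (A i)"
    and hall: "\<And>J. finite J \<Longrightarrow> J \<subseteq> I \<Longrightarrow> card J \<le> card (\<Union>(A ` J))"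
  obtains f where "inj_on f I" "\<And>i. i \<in> I \<Longrightarrow> f i \<in> A i"
proof -
  define Q where "Q D \<longleftrightarrow> D \<subseteq> Sigma I A \<and>
    (\<forall>J. finite J \<longrightarrow> J \<subseteq> I \<longrightarrow> card J \<le> card ((Sigma I A - D) `` J))" for D
  have "Sigma I A `` J = \<Union>(A ` J)" if "J \<subseteq> I" for J
    using that by blast
  then have "Q {}"
    using hall by (simp add: Q_def)
  then have "\<exists>M\<in>Collect Q. \<forall>D\<in>Collect Q. M \<subseteq> D \<longrightarrow> D = M"
  proof (intro subset_Zorn_nonempty)
    fix C assume C: "C \<noteq> {}" "subset.chain (Collect Q) C"
    have "card J \<le> card ((Sigma I A - \<Union>C) `` J)" if J: "finite J" "J \<subseteq> I" for J
    proof -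
      have "finite (\<Union>C \<inter> Sigma J A)"
        using J fin by (intro finite_Int) (auto intro!: finite_SigmaI)
      \<comment> \<open>For a finite \<open>J\<close> only finitely many pairs matter, and one
        member of the chain already contains all of them that lie in the union.\<close>
      then obtain D where D: "D \<in> C" "\<Union>C \<inter> Sigma J A \<subseteq> D"
        using finite_subset_Union_chain[of "\<Union>C \<inter> Sigma J A" C "Collect Q"] C by auto
      have "(Sigma I A - \<Union>C) `` J = (Sigma I A - D) `` J"
        using D J by blast
      moreover have "Q D"
        using C D by (auto simp: subset.chain_def)
      ultimately show ?thesis
        using J by (simp add: Q_def)
    qed
    moreover have "D \<subseteq> Sigma I A" if "D \<in> C" for D
      using C that unfolding subset.chain_def Q_def by blast
    then have "\<Union>C \<subseteq> Sigma I A"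
      by blast
    ultimately show "\<Union>C \<in> Collect Q"
      by (simp add: Q_def)
  qed auto
  then obtain M where M: "Q M" and max: "\<And>D. Q D \<Longrightarrow> M \<subseteq> D \<Longrightarrow> D = M"
    by auto
  define P where "P = Sigma I A - M"
  have P: "card J \<le> card (P `` J)" if "finite J" "J \<subseteq> I" for J
    using M that by (simp add: Q_def P_def)
  have finP: "finite (P `` J)" if "finite J" "J \<subseteq> I" for J
  proof -
    have "P `` J \<subseteq> \<Union>(A ` J)"
      by (auto simp: P_def)
    then show ?thesis
      using that fin by (meson finite_UN_I finite_subset subsetD)
  qed
  \<comment> \<open>By maximality, removing \<open>(i, x)\<close> breaks Hall's condition for some
    finite set, which must contain \<open>i\<close>; the witness is that set without
    \<open>i\<close>.\<close>
  have remove: "\<exists>J. finite J \<and> J \<subseteq> I \<and> i \<notin> J \<and> card (P `` J \<union> (P `` {i} - {x})) \<le> card J"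
    if i: "(i, x) \<in> P" for i x
  proof -
    have "\<not> Q (insert (i, x) M)"
      using max[of "insert (i, x) M"] i by (auto simp: P_def)
    then obtain J where J: "finite J" "J \<subseteq> I" "card ((Sigma I A - insert (i, x) M) `` J) < card J"
      using M i by (auto simp: Q_def P_def not_le)
    have eq: "Sigma I A - insert (i, x) M = P - {(i, x)}"
      by (auto simp: P_def)
    have "i \<in> J"
    proof (rule ccontr)
      assume "i \<notin> J"
      then have "(P - {(i, x)}) `` J = P `` J"
        by auto
      then show False
        using J P[of J] by (simp add: eq)
    qed
    moreover have "P `` (J - {i}) \<union> (P `` {i} - {x}) \<subseteq> (P - {(i, x)}) `` J"
      using \<open>i \<in> J\<close> by auto
    moreover have "finite ((P - {(i, x)}) `` J)"
      by (rule finite_subset[OF _ finP[OF J(1,2)]]) auto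
    ultimately have "card (P `` (J - {i}) \<union> (P `` {i} - {x})) \<le> card ((P - {(i, x)}) `` J)"
      by (meson card_mono)
    then have "card (P `` (J - {i}) \<union> (P `` {i} - {x})) \<le> card (J - {i})"
      using J eq \<open>i \<in> J\<close> by simp
    then show ?thesis
      using J by (intro exI[of _ "J - {i}"]) auto
  qed
  have uniq: "x = y" if xy: "(i, x) \<in> P" "(i, y) \<in> P" for i x y
  proof (rule ccontr)
    assume ne: "x \<noteq> y"
    have i: "i \<in> I"
      using xy by (auto simp: P_def)
    obtain J where J: "finite J" "J \<subseteq> I" "i \<notin> J" "card (P `` J \<union> (P `` {i} - {x})) \<le> card J"
      using remove[OF xy(1)] by blast
    obtain K where K: "finite K" "K \<subseteq> I" "i \<notin> K" "card (P `` K \<union> (P `` {i} - {y})) \<le> card K"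
      using remove[OF xy(2)] by blast
    let ?U = "P `` J \<union> (P `` {i} - {x})" and ?V = "P `` K \<union> (P `` {i} - {y})"
    have fin: "finite ?U" "finite ?V"
      using J K i by (auto intro!: finP)
    have "P `` (insert i (J \<union> K)) \<subseteq> ?U \<union> ?V"
      using ne by auto
    then have "card (insert i (J \<union> K)) \<le> card (?U \<union> ?V)"
      using P[of "insert i (J \<union> K)"] J K i fin
      by (meson card_mono finite_UnI finite_insert insert_subset le_trans sup.boundedI)
    moreover have "P `` (J \<inter> K) \<subseteq> ?U \<inter> ?V"
      by auto
    then have "card (J \<inter> K) \<le> card (?U \<inter> ?V)"
      using P[of "J \<inter> K"] J K fin by (meson card_mono finite_Int inf.coboundedI1 le_trans)
    \<comment> \<open>Submodularity: Hall's condition for the two sets adds up to at least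
      \<open>card J + card K + 1\<close>, as \<open>i\<close> lies in neither \<open>J\<close> nor
      \<open>K\<close>, whereas \<open>?U\<close> and \<open>?V\<close> together have at most
      \<open>card J + card K\<close> elements.\<close>
    ultimately show False
      using J K card_Un_Int[OF fin] card_Un_Int[OF J(1) K(1)] by simp
  qed
  have ex: "\<exists>x. (i, x) \<in> P" if "i \<in> I" for i
  proof (rule ccontr)
    assume "\<nexists>x. (i, x) \<in> P"
    then have "P `` {i} = {}"
      by auto
    then show False
      using P[of "{i}"] that by simp
  qed
  define f where "f i = (SOME x. (i, x) \<in> P)" for i
  have f: "(i, f i) \<in> P" if "i \<in> I" for i
    unfolding f_def using ex[OF that] by (rule someI_ex)
  show thesis
  proof
    show "f i \<in> A i" if "i \<in> I" for i
      using f[OF that] by (simp add: P_def)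
    show "inj_on f I"
    proof (rule inj_onI, rule ccontr)
      fix i j assume ij: "i \<in> I" "j \<in> I" "f i = f j" "i \<noteq> j"
      then have "P `` {i, j} = {f i}"
        using f uniq by auto
      then show False
        using P[of "{i, j}"] ij by simp
    qed
  qed
qed

locale mean = group +
  fixes \<mu> :: "'a set \<Rightarrow> real"
  assumes mean_nonneg: "\<And>A. A \<subseteq> carrier G \<Longrightarrow> 0 \<le> \<mu> A"
    and mean_carrier: "\<mu> (carrier G) = 1"
    and mean_Un: "\<And>A B. A \<subseteq> carrier G \<Longrightarrow> B \<subseteq> carrier G \<Longrightarrow> A \<inter> B = {} \<Longrightarrow> \<mu> (A \<union> B) = \<mu> A + \<mu> B"
    and mean_l_coset: "\<And>g A. g \<in> carrier G \<Longrightarrow> A \<subseteq> carrier G \<Longrightarrow> \<mu> (g <# A) = \<mu> A"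

lemma (in group) amenable_mean:
  assumes "amenable G"
  obtains \<mu> where "mean G \<mu>"
proof -
  obtain \<mu> :: "'a set \<Rightarrow> real" where \<mu>: "\<forall>A \<subseteq> carrier G. 0 \<le> \<mu> A" "\<mu> (carrier G) = 1"
    "\<forall>A B. A \<subseteq> carrier G \<longrightarrow> B \<subseteq> carrier G \<longrightarrow> A \<inter> B = {} \<longrightarrow> \<mu> (A \<union> B) = \<mu> A + \<mu> B"
    "\<forall>g \<in> carrier G. \<forall>A \<subseteq> carrier G. \<mu> (g <# A) = \<mu> A"
    using assms unfolding amenable_def by (elim exE conjE) (rule that)
  have "mean G \<mu>"
  proof
    show "0 \<le> \<mu> A" if "A \<subseteq> carrier G" for A
      using \<mu>(1) that by blast
    show "\<mu> (A \<union> B) = \<mu> A + \<mu> B" if "A \<subseteq> carrier G" "B \<subseteq> carrier G" "A \<inter> B = {}" for A B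
      using \<mu>(3) that by blast
    show "\<mu> (g <# A) = \<mu> A" if "g \<in> carrier G" "A \<subseteq> carrier G" for g A
      using \<mu>(4) that by blast
  qed (rule \<mu>(2))
  then show thesis
    by (rule that)
qed

context mean
begin

lemma mean_empty: "\<mu> {} = 0"
  using mean_Un[of "{}" "{}"] by simp

lemma mean_mono:
  assumes "A \<subseteq> B" "B \<subseteq> carrier G"
  shows "\<mu> A \<le> \<mu> B"
proof -
  have "\<mu> (A \<union> (B - A)) = \<mu> A + \<mu> (B - A)"
    using assms by (intro mean_Un) auto
  moreover have "A \<union> (B - A) = B" "0 \<le> \<mu> (B - A)"
    using assms by (auto intro: mean_nonneg)
  ultimately show ?thesis
    by simp
qed

lemma mean_Un_le:
  assumes "A \<subseteq> carrier G" "B \<subseteq> carrier G"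
  shows "\<mu> (A \<union> B) \<le> \<mu> A + \<mu> B"
proof -
  have "\<mu> (A \<union> (B - A)) = \<mu> A + \<mu> (B - A)"
    using assms by (intro mean_Un) auto
  moreover have "\<mu> (B - A) \<le> \<mu> B"
    using assms by (intro mean_mono) auto
  ultimately show ?thesis
    by simp
qed

lemma mean_UN:
  assumes "finite I" "\<And>i. i \<in> I \<Longrightarrow> A i \<subseteq> carrier G" "disjoint_family_on A I"
  shows "\<mu> (\<Union>i\<in>I. A i) = (\<Sum>i\<in>I. \<mu> (A i))"
  using assms
proof (induction I)
  case (insert i I)
  then have "disjoint_family_on A I" "A i \<inter> (\<Union>i\<in>I. A i) = {}"
    by (auto simp: disjoint_family_on_def)
  then show ?case
    using insert mean_Un[of "A i" "\<Union>i\<in>I. A i"] by (auto simp: UN_subset_iff)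
qed (simp add: mean_empty)

text \<open>A two-to-one map with bounded displacement would make the mean of \<open>G\<close> at least \<open>2\<close>.\<close>

lemma no_doubling:
  assumes P: "finite P" "P \<subseteq> carrier G"
    and dbl: "\<And>F. finite F \<Longrightarrow> F \<subseteq> carrier G \<Longrightarrow> 2 * card F \<le> card (F <#> P)"
  shows False
proof -
  \<comment> \<open>Doubling gives Hall's condition for two copies of the group; \<open>f\<close>
    embeds both disjointly, moving each element only by a right factor in \<open>P\<close>.\<close>
  obtain f :: "'a \<times> bool \<Rightarrow> 'a" where f: "inj_on f (carrier G \<times> UNIV)"
    "\<And>i. i \<in> carrier G \<times> UNIV \<Longrightarrow> f i \<in> {fst i} <#> P"
  proof (rule hall_infinite[of "carrier G \<times> (UNIV :: bool set)" "\<lambda>i. {fst i} <#> P"])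
    show "finite ({fst i} <#> P)" for i :: "'a \<times> bool"
      using P by (simp add: set_mult_def)
    fix J :: "('a \<times> bool) set" assume J: "finite J" "J \<subseteq> carrier G \<times> UNIV"
    have "J \<subseteq> fst ` J \<times> UNIV"
      by force
    then have "card J \<le> card (fst ` J \<times> (UNIV :: bool set))"
      using J by (intro card_mono) auto
    also have "\<dots> = 2 * card (fst ` J)"
      by (simp add: card_cartesian_product)
    also have "\<dots> \<le> card (fst ` J <#> P)"
      using J by (intro dbl) auto
    also have "fst ` J <#> P = (\<Union>i\<in>J. {fst i} <#> P)"
      by (auto simp: set_mult_def)
    finally show "card J \<le> card (\<Union>i\<in>J. {fst i} <#> P)" .
  qed blast
  \<comment> \<open>The displacement by \<open>q\<close> is a right multiplication but the mean is
    left invariant. Everything is therefore read through inversion: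
    \<open>inv (f (inv g, b)) = inv q \<otimes> g\<close> on \<open>A (b, q)\<close>.\<close>
  define A where "A = (\<lambda>(b, q). {g \<in> carrier G. f (inv g, b) = inv g \<otimes> q})"
  have Asub: "A i \<subseteq> carrier G" for i
    by (auto simp: A_def split: prod.splits)
  have half: "(\<Sum>q\<in>P. \<mu> (A (b, q))) = 1" for b
  proof -
    have "disjoint_family_on (\<lambda>q. A (b, q)) P"
      unfolding disjoint_family_on_def A_def using P by auto (metis inv_closed l_cancel subsetD)
    then have "\<mu> (\<Union>q\<in>P. A (b, q)) = (\<Sum>q\<in>P. \<mu> (A (b, q)))"
      using P Asub by (intro mean_UN) auto
    moreover have "(\<Union>q\<in>P. A (b, q)) = carrier G"
    proof
      show "carrier G \<subseteq> (\<Union>q\<in>P. A (b, q))"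
      proof
        fix g assume g: "g \<in> carrier G"
        then have "f (inv g, b) \<in> {inv g} <#> P"
          using f(2)[of "(inv g, b)"] by simp
        then show "g \<in> (\<Union>q\<in>P. A (b, q))"
          using g by (auto simp: A_def set_mult_def)
      qed
    qed (use Asub in auto)
    ultimately show ?thesis
      using mean_carrier by simp
  qed
  \<comment> \<open>The inverted images of the pieces: translates of the \<open>A i\<close>,
    disjoint because \<open>f\<close> is injective. Their means add up to at most 1, while those of
    the \<open>A i\<close> add up to 1 for each of the two values of \<open>b\<close>.\<close>
  define B where "B i = inv (snd i) <# A i" for i :: "bool \<times> 'a"
  have Bimg: "B i = (\<lambda>g. inv (f (inv g, fst i))) ` A i" if "snd i \<in> P" for i :: "bool \<times> 'a"
    using that P by (auto simp: B_def A_def l_coset_def inv_mult_group subset_iff split: prod.splits)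
  have Bsub: "B i \<subseteq> carrier G" if "i \<in> UNIV \<times> P" for i :: "bool \<times> 'a"
    unfolding B_def using that P Asub by (intro l_coset_subset_G) auto
  have "disjoint_family_on B (UNIV \<times> P)"
    unfolding disjoint_family_on_def
  proof (intro ballI impI)
    fix i j :: "bool \<times> 'a" assume ij: "i \<in> UNIV \<times> P" "j \<in> UNIV \<times> P" "i \<noteq> j"
    show "B i \<inter> B j = {}"
    proof (rule ccontr)
      assume "B i \<inter> B j \<noteq> {}"
      then obtain z where z: "z \<in> B i" "z \<in> B j"
        by blast
      have "snd i \<in> P" "snd j \<in> P"
        using ij by auto
      from z(1)[unfolded Bimg[OF this(1)]] z(2)[unfolded Bimg[OF this(2)]]
      obtain g h where gh: "g \<in> A i" "h \<in> A j" "inv (f (inv g, fst i)) = inv (f (inv h, fst j))"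
        by (elim imageE) simp
      have c: "g \<in> carrier G" "h \<in> carrier G" "snd i \<in> carrier G" "snd j \<in> carrier G"
        using gh Asub ij P by auto
      have eqs: "f (inv g, fst i) = inv g \<otimes> snd i" "f (inv h, fst j) = inv h \<otimes> snd j"
        using gh by (auto simp: A_def split: prod.splits)
      then have "f (inv g, fst i) = f (inv h, fst j)"
        using gh(3) c by (metis inv_closed inv_inv m_closed)
      then have "(inv g, fst i) = (inv h, fst j)"
        using c by (intro inj_onD[OF f(1)]) auto
      then have "inv g \<otimes> snd i = inv g \<otimes> snd j" "fst i = fst j"
        using eqs by auto
      then show False
        using c ij by (auto simp: prod_eq_iff)
    qed
  qed
  then have "(\<Sum>i\<in>UNIV \<times> P. \<mu> (B i)) = \<mu> (\<Union>i\<in>UNIV \<times> P. B i)"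
    using P by (intro mean_UN[symmetric] Bsub) auto
  also have "\<dots> \<le> \<mu> (carrier G)"
    by (intro mean_mono UN_least Bsub) auto
  also have "\<dots> = 1"
    by (rule mean_carrier)
  finally have "(\<Sum>i\<in>UNIV \<times> P. \<mu> (B i)) \<le> 1" .
  moreover have "\<mu> (B i) = \<mu> (A i)" if "i \<in> UNIV \<times> P" for i :: "bool \<times> 'a"
    unfolding B_def using that P Asub by (intro mean_l_coset) auto
  then have "(\<Sum>i\<in>UNIV \<times> P. \<mu> (B i)) = (\<Sum>i\<in>UNIV \<times> P. \<mu> (A i))"
    by (rule sum.cong[OF refl])
  moreover have "(\<Sum>i\<in>UNIV \<times> P. \<mu> (A i)) = (\<Sum>b\<in>UNIV. \<Sum>q\<in>P. \<mu> (A (b, q)))"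
    using P by (simp add: sum.cartesian_product)
  ultimately show False
    by (simp add: half)
qed

text \<open>Without such a set every finite \<open>F\<close> grows by a fixed factor under
  multiplication by \<open>S\<close> and \<open>\<one>\<close>; iterating until the factor exceeds 2
  contradicts \<open>no_doubling\<close>.\<close>

lemma folner:
  assumes S: "finite S" "S \<subseteq> carrier G" and \<delta>: "\<delta> > (0 :: real)"
  obtains F where "finite F" "F \<noteq> {}" "F \<subseteq> carrier G"
    "real (card {(f, s) \<in> F \<times> S. f \<otimes> s \<notin> F}) \<le> \<delta> * real (card F)"
proof (rule ccontr)
  assume neg: "\<not> thesis"
  note witness = that
  have big: "\<delta> * real (card F) < real (card {(f, s) \<in> F \<times> S. f \<otimes> s \<notin> F})"
    if "finite F" "F \<noteq> {}" "F \<subseteq> carrier G" for F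
    using that neg witness[of F] by linarith
  have S0: "card S > 0"
  proof (rule ccontr)
    assume "\<not> card S > 0"
    then have "S = {}"
      using S by auto
    then show False
      using big[of "{\<one>}"] \<delta> by simp
  qed
  define T where "T = insert \<one> S"
  have T: "finite T" "T \<subseteq> carrier G"
    using S by (auto simp: T_def)
  \<comment> \<open>More than \<open>\<delta> * card F\<close> pairs leave a nonempty
    \<open>F\<close>, and each \<open>s\<close> accounts for at most
    \<open>card ((F <#> T) - F)\<close> of them; dividing by \<open>card S\<close> bounds the number
    of new elements from below.\<close>
  define q where "q = 1 + \<delta> / card S"
  have q: "q > 1"
    using S0 \<delta> by (simp add: q_def)
  have grow: "q * real (card F) \<le> real (card (F <#> T))" if F: "finite F" "F \<subseteq> carrier G" for F
  proof (cases "F = {}")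
    case False
    have finFT: "finite (F <#> T)"
      using F T by (simp add: set_mult_def)
    have sub: "F \<subseteq> F <#> T"
      using F by (force simp: set_mult_def T_def)
    have "{(f, s) \<in> F \<times> S. f \<otimes> s \<notin> F} = (\<lambda>(s, f). (f, s)) ` (SIGMA s:S. {f \<in> F. f \<otimes> s \<notin> F})"
      by auto
    then have "card {(f, s) \<in> F \<times> S. f \<otimes> s \<notin> F} = card (SIGMA s:S. {f \<in> F. f \<otimes> s \<notin> F})"
      by (simp add: card_image inj_on_def split_beta prod_eq_iff)
    also have "\<dots> = (\<Sum>s\<in>S. card {f \<in> F. f \<otimes> s \<notin> F})"
      using S F by (intro card_SigmaI) auto
    also have "\<dots> \<le> (\<Sum>s\<in>S. card ((F <#> T) - F))"
    proof (rule sum_mono)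
      fix s assume s: "s \<in> S"
      show "card {f \<in> F. f \<otimes> s \<notin> F} \<le> card ((F <#> T) - F)"
      proof (rule card_inj_on_le)
        show "inj_on (\<lambda>f. f \<otimes> s) {f \<in> F. f \<otimes> s \<notin> F}"
          using s S F by (auto simp: inj_on_def subset_iff)
        show "(\<lambda>f. f \<otimes> s) ` {f \<in> F. f \<otimes> s \<notin> F} \<subseteq> (F <#> T) - F"
          using s by (auto simp: set_mult_def T_def)
      qed (use finFT in auto)
    qed
    also have "\<dots> = card S * (card (F <#> T) - card F)"
      using finFT F sub by (simp add: card_Diff_subset)
    finally have "\<delta> * real (card F) < real (card S * (card (F <#> T) - card F))"
      using big[OF F(1) False F(2)] by linarith
    also have "\<dots> = real (card S) * (real (card (F <#> T)) - real (card F))"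
      using card_mono[OF finFT sub] by (simp add: of_nat_diff)
    finally show ?thesis
      using S0 by (simp add: q_def field_simps)
  qed simp
  define P where "P k = ((\<lambda>A. A <#> T) ^^ k) {\<one>}" for k :: nat
  have P: "finite (P k) \<and> P k \<subseteq> carrier G" for k
    using T by (induction k) (auto simp: P_def set_mult_def)
  have iter: "q ^ k * real (card F) \<le> real (card (F <#> P k))" if F: "finite F" "F \<subseteq> carrier G" for F k
  proof (induction k)
    case 0
    have "F <#> P 0 = F"
      using F by (force simp: P_def set_mult_def)
    then show ?case
      by simp
  next
    case (Suc k)
    have FP: "finite (F <#> P k)" "F <#> P k \<subseteq> carrier G"
      using F P[of k] by (auto simp: set_mult_def)
    have "F <#> P (Suc k) = (F <#> P k) <#> T"
      using F P[of k] T by (simp add: P_def set_mult_assoc)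
    moreover have "q * (q ^ k * real (card F)) \<le> q * real (card (F <#> P k))"
      using Suc q by (intro mult_left_mono) auto
    ultimately show ?case
      using grow[OF FP] by (simp add: mult.assoc)
  qed
  obtain k where k: "2 < q ^ k"
    using real_arch_pow[OF q] by blast
  have "2 * card F \<le> card (F <#> P k)" if F: "finite F" "F \<subseteq> carrier G" for F
  proof -
    have "2 * real (card F) \<le> q ^ k * real (card F)"
      using k by (intro mult_right_mono) auto
    then show ?thesis
      using iter[OF F, of k] by linarith
  qed
  then show False
    using no_doubling[of "P k"] P[of k] by blast
qed

end

section \<open>Hyperfiniteness of Schreier graphs\<close>

lemma sum_of_bool_card: "finite A \<Longrightarrow> (\<Sum>a\<in>A. of_bool (P a)) = card {a \<in> A. P a}"
  by (simp add: sum_of_bool_eq Int_def)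

lemma card_pairs:
  assumes "finite A" "finite B"
  shows "card {(a, b) \<in> A \<times> B. P a b} = (\<Sum>a\<in>A. \<Sum>b\<in>B. of_bool (P a b))"
proof -
  have "{(a, b) \<in> A \<times> B. P a b} = {p \<in> A \<times> B. P (fst p) (snd p)}"
    by auto
  then have "card {(a, b) \<in> A \<times> B. P a b} = (\<Sum>p\<in>A \<times> B. of_bool (P (fst p) (snd p)))"
    using assms by (simp only: sum_of_bool_card finite_cartesian_product)
  then show ?thesis
    by (simp add: sum.cartesian_product split_beta)
qed

context group
begin

lemma rcosets_mult:
  assumes "subgroup H G" "Y \<in> rcosets H" "g \<in> carrier G"
  shows "Y #> g \<in> rcosets H"
  using assms by (auto simp: RCOSETS_def coset_mult_assoc subgroup.subset)

lemma rcosets_mult_assoc: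
  assumes "subgroup H G" "Y \<in> rcosets H" "g \<in> carrier G" "h \<in> carrier G"
  shows "(Y #> g) #> h = Y #> (g \<otimes> h)"
  using assms by (intro coset_mult_assoc) (auto dest: subgroup.rcosets_carrier[OF _ is_group])

lemma rcosets_mult_one:
  assumes "subgroup H G" "Y \<in> rcosets H"
  shows "Y #> \<one> = Y"
  using assms by (intro coset_mult_one) (auto dest: subgroup.rcosets_carrier[OF _ is_group])

lemma rcosets_mult_inv:
  assumes "subgroup H G" "Y \<in> rcosets H" "g \<in> carrier G"
  shows "(Y #> g) #> inv g = Y" "(Y #> inv g) #> g = Y"
  using assms by (simp_all add: rcosets_mult_assoc rcosets_mult_one)

text \<open>
  A random translate of the Foelner set \<open>F\<close>, counted with multiplicity, has small boundary; so
  has one of its level sets.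
\<close>

lemma folner_piece:
  assumes H: "subgroup H G" "finite (rcosets H)"
    and F: "finite F" "F \<noteq> {}" "F \<subseteq> carrier G"
    and S: "finite S" "S \<subseteq> carrier G"
    and folner: "real (card {(f, s) \<in> F \<times> S. f \<otimes> s \<notin> F}) \<le> \<delta> * real (card F)"
    and W: "W \<subseteq> rcosets H" "\<epsilon> * real (card (rcosets H)) < real (card W)"
    and pos: "\<delta> > 0" "\<epsilon> > 0"
  obtains U where "U \<noteq> {}" "U \<subseteq> W" "card U \<le> card F"
    "real (card {(y, s) \<in> U \<times> S. y #> s \<in> W - U}) \<le> \<delta> / \<epsilon> * real (card U)"
proof (rule ccontr)
  assume neg: "\<not> thesis"
  note witness = that
  define C where "C = rcosets H"
  note finC = H(2)[folded C_def]
  have finX: "finite W"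
    using W finC finite_subset C_def by blast
  \<comment> \<open>The multiplicity of \<open>y\<close> in the translate of \<open>F\<close> based
    at the coset \<open>x\<close>; distinct elements of \<open>F\<close> may lead to the same
    coset.\<close>
  define \<phi> where "\<phi> x y = card {f \<in> F. x #> f = y}" for x y
  define U where "U x t = {y \<in> W. t \<le> \<phi> x y}" for x t
  define b where "b x t = card {(y, s) \<in> U x t \<times> S. y #> s \<in> W - U x t}" for x t
  let ?I = "{1..card F}"
  have \<phi>_le: "\<phi> x y \<le> card F" for x y
    unfolding \<phi>_def using F by (intro card_mono) auto
  have U: "U x t \<subseteq> W" "card (U x t) \<le> card F" if "t \<in> ?I" for x t
  proof -
    have "U x t \<subseteq> (\<lambda>f. x #> f) ` F"
    proof
      fix y assume "y \<in> U x t"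
      then have "card {f \<in> F. x #> f = y} > 0"
        using that by (simp add: U_def \<phi>_def)
      then show "y \<in> (\<lambda>f. x #> f) ` F"
        by (auto simp: card_gt_0_iff)
    qed
    then show "card (U x t) \<le> card F"
      using F by (meson card_image_le card_mono finite_imageI le_trans)
  qed (auto simp: U_def)
  have layer: "(\<Sum>t\<in>?I. of_bool (t \<le> k)) = k" if "k \<le> card F" for k :: nat
  proof -
    have "(\<Sum>t\<in>?I. of_bool (t \<le> k)) = card {t \<in> ?I. t \<le> k}"
      by (simp add: sum_of_bool_card del: sum_of_bool_eq)
    also have "{t \<in> ?I. t \<le> k} = {1..k}"
      using that by auto
    finally show ?thesis
      by simp
  qed
  have \<phi>_sum: "\<phi> x y = (\<Sum>f\<in>F. of_bool (x #> f = y))" for x y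
    using F by (simp add: \<phi>_def sum_of_bool_card del: sum_of_bool_eq)
  \<comment> \<open>Right translation by \<open>f\<close> permutes the cosets, so each
    \<open>f\<close> hits each \<open>y\<close> exactly once as \<open>x\<close> varies. Only those
    \<open>y\<close> in \<open>W\<close> count, which is what costs the factor
    \<open>1 / \<epsilon>\<close> in the end.\<close>
  have total: "(\<Sum>x\<in>C. \<Sum>t\<in>?I. card (U x t)) = card F * card W"
  proof -
    have "(\<Sum>x\<in>C. \<Sum>t\<in>?I. card (U x t)) = (\<Sum>x\<in>C. \<Sum>t\<in>?I. \<Sum>y\<in>W. of_bool (t \<le> \<phi> x y))"
      using finX by (simp add: U_def sum_of_bool_card del: sum_of_bool_eq)
    also have "\<dots> = (\<Sum>x\<in>C. \<Sum>y\<in>W. \<Sum>t\<in>?I. of_bool (t \<le> \<phi> x y))"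
      by (intro sum.cong refl sum.swap)
    also have "\<dots> = (\<Sum>x\<in>C. \<Sum>y\<in>W. \<phi> x y)"
      using \<phi>_le by (simp only: layer)
    also have "\<dots> = (\<Sum>y\<in>W. \<Sum>x\<in>C. \<Sum>f\<in>F. of_bool (x #> f = y))"
      unfolding \<phi>_sum by (rule sum.swap)
    also have "\<dots> = (\<Sum>y\<in>W. \<Sum>f\<in>F. \<Sum>x\<in>C. of_bool (x #> f = y))"
      by (intro sum.cong refl sum.swap)
    also have "\<dots> = (\<Sum>y\<in>W. \<Sum>f\<in>F. 1)"
    proof (intro sum.cong refl)
      fix y f assume y: "y \<in> W" and "f \<in> F"
      then have f: "f \<in> carrier G" and yC: "y \<in> C"
        using F W by (auto simp: C_def)
      have "{x \<in> C. x #> f = y} = {y #> inv f}"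
        using f yC rcosets_mult_inv[OF H(1)] rcosets_mult[OF H(1)] by (auto simp: C_def)
      moreover have "(\<Sum>x\<in>C. of_bool (x #> f = y)) = card {x \<in> C. x #> f = y}"
        using finC by (simp add: sum_of_bool_card del: sum_of_bool_eq)
      ultimately show "(\<Sum>x\<in>C. of_bool (x #> f = y)) = (1 :: nat)"
        by simp
    qed
    finally show ?thesis
      by (simp add: mult.commute)
  qed
  \<comment> \<open>Truncated subtraction counts the levels \<open>t\<close> at which the pair
    \<open>(y, s)\<close> leaves the level set: those above \<open>\<phi> x (y #> s)\<close> and at
    most \<open>\<phi> x y\<close>. Each is paid for by an element of \<open>F\<close> that
    \<open>s\<close> pushes out of \<open>F\<close>.\<close>
  have diff: "\<phi> x y - \<phi> x (y #> s) \<le> card {f \<in> F. x #> f = y \<and> f \<otimes> s \<notin> F}"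
    if "x \<in> C" "s \<in> S" for x y s
  proof -
    have s: "s \<in> carrier G"
      using that S by auto
    have "card {f \<in> F. x #> f = y \<and> f \<otimes> s \<in> F} \<le> \<phi> x (y #> s)"
      unfolding \<phi>_def
    proof (rule card_inj_on_le)
      show "inj_on (\<lambda>f. f \<otimes> s) {f \<in> F. x #> f = y \<and> f \<otimes> s \<in> F}"
        using s F by (auto simp: inj_on_def subset_iff)
      show "(\<lambda>f. f \<otimes> s) ` {f \<in> F. x #> f = y \<and> f \<otimes> s \<in> F} \<subseteq> {f \<in> F. x #> f = y #> s}"
        using s F that rcosets_mult_assoc[OF H(1)] by (auto simp: C_def subset_iff)
    qed (use F in auto)
    moreover have "{f \<in> F. x #> f = y}
        = {f \<in> F. x #> f = y \<and> f \<otimes> s \<in> F} \<union> {f \<in> F. x #> f = y \<and> f \<otimes> s \<notin> F}"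
      by auto
    then have "\<phi> x y \<le> card {f \<in> F. x #> f = y \<and> f \<otimes> s \<in> F} + card {f \<in> F. x #> f = y \<and> f \<otimes> s \<notin> F}"
      using card_Un_le[of "{f \<in> F. x #> f = y \<and> f \<otimes> s \<in> F}" "{f \<in> F. x #> f = y \<and> f \<otimes> s \<notin> F}"]
      by (simp only: \<phi>_def)
    ultimately show ?thesis
      by linarith
  qed
  have bdry: "(\<Sum>x\<in>C. \<Sum>t\<in>?I. b x t) \<le> card C * card {(f, s) \<in> F \<times> S. f \<otimes> s \<notin> F}"
  proof -
    have step: "(\<Sum>t\<in>?I. b x t) \<le> card {(f, s) \<in> F \<times> S. f \<otimes> s \<notin> F}" if x: "x \<in> C" for x
    proof -
      have "b x t = (\<Sum>y\<in>W. \<Sum>s\<in>S. of_bool (t \<le> \<phi> x y \<and> y #> s \<in> W - U x t))" for t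
        unfolding b_def using finX S by (subst card_pairs[symmetric]) (auto simp: U_def intro!: arg_cong[where f = card])
      then have "(\<Sum>t\<in>?I. b x t)
          = (\<Sum>t\<in>?I. \<Sum>y\<in>W. \<Sum>s\<in>S. of_bool (t \<le> \<phi> x y \<and> y #> s \<in> W - U x t))"
        by simp
      also have "\<dots> = (\<Sum>y\<in>W. \<Sum>t\<in>?I. \<Sum>s\<in>S. of_bool (t \<le> \<phi> x y \<and> y #> s \<in> W - U x t))"
        by (rule sum.swap)
      also have "\<dots> = (\<Sum>y\<in>W. \<Sum>s\<in>S. \<Sum>t\<in>?I. of_bool (t \<le> \<phi> x y \<and> y #> s \<in> W - U x t))"
        by (intro sum.cong refl sum.swap)
      also have "\<dots> \<le> (\<Sum>y\<in>W. \<Sum>s\<in>S. card {f \<in> F. x #> f = y \<and> f \<otimes> s \<notin> F})"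
      proof (intro sum_mono)
        fix y s assume "s \<in> S"
        have "(\<Sum>t\<in>?I. of_bool (t \<le> \<phi> x y \<and> y #> s \<in> W - U x t))
            = card {t \<in> ?I. t \<le> \<phi> x y \<and> y #> s \<in> W - U x t}"
          by (simp add: sum_of_bool_card del: sum_of_bool_eq)
        also have "\<dots> \<le> card {\<phi> x (y #> s)<..\<phi> x y}"
          by (intro card_mono) (auto simp: U_def)
        also have "\<dots> \<le> card {f \<in> F. x #> f = y \<and> f \<otimes> s \<notin> F}"
          using diff[OF x \<open>s \<in> S\<close>] by simp
        finally show "(\<Sum>t\<in>?I. of_bool (t \<le> \<phi> x y \<and> y #> s \<in> W - U x t))
            \<le> card {f \<in> F. x #> f = y \<and> f \<otimes> s \<notin> F}" .
      qed
      also have "\<dots> = (\<Sum>s\<in>S. \<Sum>y\<in>W. card {f \<in> F. x #> f = y \<and> f \<otimes> s \<notin> F})"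
        by (rule sum.swap)
      also have "\<dots> \<le> (\<Sum>s\<in>S. card {f \<in> F. f \<otimes> s \<notin> F})"
      proof (intro sum_mono)
        fix s
        have "(\<Sum>y\<in>W. card {f \<in> F. x #> f = y \<and> f \<otimes> s \<notin> F})
            = card (\<Union>y\<in>W. {f \<in> F. x #> f = y \<and> f \<otimes> s \<notin> F})"
          using finX F by (intro card_UN_disjoint[symmetric]) auto
        also have "\<dots> \<le> card {f \<in> F. f \<otimes> s \<notin> F}"
          using F by (intro card_mono) auto
        finally show "(\<Sum>y\<in>W. card {f \<in> F. x #> f = y \<and> f \<otimes> s \<notin> F}) \<le> card {f \<in> F. f \<otimes> s \<notin> F}" .
      qed
      also have "\<dots> = (\<Sum>s\<in>S. \<Sum>f\<in>F. of_bool (f \<otimes> s \<notin> F))"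
        using F by (simp add: sum_of_bool_card del: sum_of_bool_eq)
      also have "\<dots> = (\<Sum>f\<in>F. \<Sum>s\<in>S. of_bool (f \<otimes> s \<notin> F))"
        by (rule sum.swap)
      also have "\<dots> = card {(f, s) \<in> F \<times> S. f \<otimes> s \<notin> F}"
        using F S by (intro card_pairs[symmetric])
      finally show ?thesis .
    qed
    show ?thesis
      using sum_bounded_above[of C "\<lambda>x. \<Sum>t\<in>?I. b x t", OF step] by simp
  qed
  have big: "\<delta> / \<epsilon> * real (card (U x t)) \<le> real (b x t)" if "t \<in> ?I" for x t
  proof (cases "U x t = {}")
    case False
    then show ?thesis
      using witness[of "U x t"] neg U[OF that, of x] by (auto simp: b_def not_le less_imp_le)
  qed simp
  \<comment> \<open>If no level set qualified, the boundaries summed over all base points and levels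
    would exceed \<open>\<delta> * card C * card F\<close>; the strict inequality comes from the
    lower bound on \<open>card W\<close>.\<close>
  have "\<delta> * real (card C) * real (card F) < \<delta> / \<epsilon> * real (card W) * real (card F)"
    using W(2) pos F by (simp add: C_def field_simps card_gt_0_iff)
  also have "\<dots> = \<delta> / \<epsilon> * real (\<Sum>x\<in>C. \<Sum>t\<in>?I. card (U x t))"
    by (simp only: total of_nat_mult mult_ac)
  also have "\<dots> = (\<Sum>x\<in>C. \<Sum>t\<in>?I. \<delta> / \<epsilon> * real (card (U x t)))"
    by (simp only: of_nat_sum sum_distrib_left)
  also have "\<dots> \<le> (\<Sum>x\<in>C. \<Sum>t\<in>?I. real (b x t))"
    by (intro sum_mono big)
  also have "\<dots> \<le> real (card C * card {(f, s) \<in> F \<times> S. f \<otimes> s \<notin> F})"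
    using of_nat_mono[OF bdry, where 'a = real] by simp
  also have "\<dots> \<le> real (card C) * (\<delta> * real (card F))"
    using folner by (simp add: mult_left_mono)
  finally show False
    by (simp add: mult_ac)
qed

text \<open>Greedy: pieces from \<open>folner_piece\<close> are split off until at most a proportion
  \<open>\<epsilon>\<close> of all cosets is left, and these become singletons. The factor 2 arises
  because \<open>folner_piece\<close> counts only the pairs leaving the piece, while here both
  directions of an edge are recorded.\<close>

lemma folner_partition:
  assumes H: "subgroup H G" "finite (rcosets H)"
    and F: "finite F" "F \<noteq> {}" "F \<subseteq> carrier G"
    and S: "finite S" "S \<subseteq> carrier G" "\<And>s. s \<in> S \<Longrightarrow> inv s \<in> S"
    and folner: "real (card {(f, s) \<in> F \<times> S. f \<otimes> s \<notin> F}) \<le> \<delta> * real (card F)"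
    and pos: "\<delta> > 0" "\<epsilon> > 0"
    and W: "W \<subseteq> rcosets H"
  shows "\<exists>\<Lambda> :: 'a set \<Rightarrow> 'a set. \<Lambda> ` W \<subseteq> W \<and> (\<forall>v. card {y \<in> W. \<Lambda> y = v} \<le> card F) \<and>
    real (card {(y, s) \<in> W \<times> S. y #> s \<in> W \<and> \<Lambda> y \<noteq> \<Lambda> (y #> s)})
      \<le> 2 * (\<delta> / \<epsilon>) * real (card W) + real (card S) * \<epsilon> * real (card (rcosets H))"
proof -
  have "finite W"
    using W H finite_subset by blast
  then show ?thesis
    using W
  proof (induction W rule: finite_psubset_induct)
    case (psubset W)
    show ?case
    proof (cases "\<epsilon> * real (card (rcosets H)) < real (card W)")
      case False
      \<comment> \<open>The leftover cosets get the identity labelling, with at most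
        \<open>card S\<close> pairs at each of them.\<close>
      have "card {(y, s) \<in> W \<times> S. y #> s \<in> W \<and> y \<noteq> y #> s} \<le> card (W \<times> S)"
        using psubset S by (intro card_mono) auto
      then have "real (card {(y, s) \<in> W \<times> S. y #> s \<in> W \<and> y \<noteq> y #> s}) \<le> real (card W * card S)"
        unfolding card_cartesian_product[symmetric] by (rule of_nat_mono)
      also have "\<dots> \<le> \<epsilon> * real (card (rcosets H)) * real (card S)"
        using False by (simp add: mult_right_mono)
      also have "\<dots> \<le> 2 * (\<delta> / \<epsilon>) * real (card W) + real (card S) * \<epsilon> * real (card (rcosets H))"
        using pos by simp
      finally have "real (card {(y, s) \<in> W \<times> S. y #> s \<in> W \<and> y \<noteq> y #> s}) \<le> \<dots>" .
      moreover have "card {y \<in> W. y = v} \<le> card F" for v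
      proof -
        have "card {y \<in> W. y = v} \<le> card {v}"
          by (intro card_mono) auto
        also have "\<dots> \<le> card F"
          using F by (simp add: Suc_le_eq card_gt_0_iff)
        finally show ?thesis .
      qed
      ultimately show ?thesis
        by (intro exI[of _ "\<lambda>y. y"]) simp
    next
      case True
      then obtain U where U: "U \<noteq> {}" "U \<subseteq> W" "card U \<le> card F"
        "real (card {(y, s) \<in> U \<times> S. y #> s \<in> W - U}) \<le> \<delta> / \<epsilon> * real (card U)"
        using folner_piece[OF H F S(1,2) folner psubset.prems _ pos] by blast
      then obtain u where u: "u \<in> U"
        by blast
      have "W - U \<subset> W"
        using U by blast
      then obtain \<Lambda> :: "'a set \<Rightarrow> 'a set" where \<Lambda>: "\<Lambda> ` (W - U) \<subseteq> W - U"
        "\<And>v. card {y \<in> W - U. \<Lambda> y = v} \<le> card F"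
        "real (card {(y, s) \<in> (W - U) \<times> S. y #> s \<in> W - U \<and> \<Lambda> y \<noteq> \<Lambda> (y #> s)})
          \<le> 2 * (\<delta> / \<epsilon>) * real (card (W - U)) + real (card S) * \<epsilon> * real (card (rcosets H))"
        using psubset.IH[of "W - U"] psubset.prems by blast
      \<comment> \<open>A piece is named by one of its own elements. The old labels on
        \<open>W - U\<close> lie in \<open>W - U\<close>, so the new name does not clash with
        them.\<close>
      define \<Lambda>' where "\<Lambda>' y = (if y \<in> U then u else \<Lambda> y)" for y
      have 1: "\<Lambda>' ` W \<subseteq> W"
        using \<Lambda>(1) u U by (auto simp: \<Lambda>'_def)
      have 2: "card {y \<in> W. \<Lambda>' y = v} \<le> card F" for v
      proof (cases "v = u")
        case True
        have "{y \<in> W. \<Lambda>' y = v} = U"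
          using True \<Lambda>(1) u U by (auto simp: \<Lambda>'_def)
        then show ?thesis
          using U by simp
      next
        case False
        have "{y \<in> W. \<Lambda>' y = v} = {y \<in> W - U. \<Lambda> y = v}"
          using False u by (auto simp: \<Lambda>'_def)
        then show ?thesis
          using \<Lambda> by simp
      qed
      let ?E = "{(y, s) \<in> W \<times> S. y #> s \<in> W \<and> \<Lambda>' y \<noteq> \<Lambda>' (y #> s)}"
      let ?E1 = "{(y, s) \<in> (W - U) \<times> S. y #> s \<in> W - U \<and> \<Lambda> y \<noteq> \<Lambda> (y #> s)}"
      let ?E2 = "{(y, s) \<in> U \<times> S. y #> s \<in> W - U}"
      let ?E3 = "{(y, s) \<in> (W - U) \<times> S. y #> s \<in> U}"
      have fin: "finite (W \<times> S)" "finite (U \<times> S)"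
        using psubset.hyps S U finite_subset[of U W] by (simp_all add: finite_cartesian_product)
      have "?E \<subseteq> ?E1 \<union> ?E2 \<union> ?E3"
      proof
        fix p assume "p \<in> ?E"
        then obtain y s where p: "p = (y, s)" "y \<in> W" "s \<in> S" "y #> s \<in> W" "\<Lambda>' y \<noteq> \<Lambda>' (y #> s)"
          by blast
        then show "p \<in> ?E1 \<union> ?E2 \<union> ?E3"
          by (cases "y \<in> U"; cases "y #> s \<in> U") (simp_all add: \<Lambda>'_def)
      qed
      moreover have "finite (?E1 \<union> ?E2 \<union> ?E3)"
        by (rule finite_subset[OF _ fin(1)]) (use U in auto)
      ultimately have "card ?E \<le> card (?E1 \<union> ?E2 \<union> ?E3)"
        by (rule card_mono[rotated])
      also have "\<dots> \<le> card ?E1 + card ?E2 + card ?E3"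
        by (meson add_le_mono1 card_Un_le le_trans)
      finally have sum3: "card ?E \<le> card ?E1 + card ?E2 + card ?E3" .
      \<comment> \<open>Reversing an edge, \<open>(y, s)\<close> to \<open>(y #> s, inv s)\<close>,
        turns the pairs entering \<open>U\<close> into pairs leaving it.\<close>
      have "card ?E3 \<le> card ?E2"
      proof (rule card_inj_on_le)
        have inv: "(y #> s) #> inv s = y" if "y \<in> W" "s \<in> S" for y s
          using that psubset.prems S by (intro rcosets_mult_inv[OF H(1)]) auto
        show "inj_on (\<lambda>(y, s). (y #> s, inv s)) ?E3"
        proof (rule inj_onI, clarify)
          fix y s z t assume *: "y \<in> W" "y \<notin> U" "s \<in> S" "y #> s \<in> U" "z \<in> W" "z \<notin> U" "t \<in> S" "z #> t \<in> U"
            and eq: "y #> s = z #> t" "inv s = inv t"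
          then have "s = t"
            using S by (metis inv_inv subsetD)
          moreover have "y = z"
            using inv[OF *(1,3)] inv[OF *(5,7)] unfolding eq by (rule trans[OF sym])
          ultimately show "y = z \<and> s = t"
            by blast
        qed
        show "(\<lambda>(y, s). (y #> s, inv s)) ` ?E3 \<subseteq> ?E2"
        proof (rule image_subsetI)
          fix p assume "p \<in> ?E3"
          then obtain y s where "p = (y, s)" "y \<in> W" "y \<notin> U" "s \<in> S" "y #> s \<in> U"
            by blast
          then show "(case p of (y, s) \<Rightarrow> (y #> s, inv s)) \<in> ?E2"
            using inv[of y s] S(3) by simp
        qed
        show "finite ?E2"
          by (rule finite_subset[OF _ fin(2)]) auto
      qed
      then have "real (card ?E) \<le> real (card ?E1) + 2 * real (card ?E2)"
        using sum3 by linarith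
      also have "\<dots> \<le> 2 * (\<delta> / \<epsilon>) * (real (card (W - U)) + real (card U)) + real (card S) * \<epsilon> * real (card (rcosets H))"
        using \<Lambda>(3) U(4) unfolding distrib_left mult.assoc by linarith
      also have "real (card (W - U)) + real (card U) = real (card W)"
        using U psubset.hyps by (simp add: card_Diff_subset finite_subset card_mono of_nat_diff)
      finally show ?thesis
        using 1 2 by blast
    qed
  qed
qed

end

text \<open>The order of quantifiers is the point: the Foelner set depends on \<open>S\<close> and
  \<open>\<eta>\<close> only, so its size bounds the pieces for all \<open>H\<close> at
  once.\<close>

lemma (in mean) hyperfinite:
  assumes S: "finite S" "S \<subseteq> carrier G" "\<And>s. s \<in> S \<Longrightarrow> inv s \<in> S" and \<eta>: "\<eta> > (0 :: real)"
  obtains K where "\<And>H. subgroup H G \<Longrightarrow> finite (rcosets H) \<Longrightarrow>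
    \<exists>\<Lambda> :: 'a set \<Rightarrow> 'a set. (\<forall>v. card {y \<in> rcosets H. \<Lambda> y = v} \<le> K) \<and>
      real (card {(y, s) \<in> (rcosets H) \<times> S. \<Lambda> y \<noteq> \<Lambda> (y #> s)}) \<le> \<eta> * real (card (rcosets H))"
proof -
  \<comment> \<open>With these constants both \<open>2 * (\<delta> / \<epsilon>)\<close> and
    \<open>card S * \<epsilon>\<close> are at most \<open>\<eta> / 2\<close>.\<close>
  define \<epsilon> where "\<epsilon> = \<eta> / (2 * (real (card S) + 1))"
  define \<delta> where "\<delta> = \<eta> * \<epsilon> / 4"
  have pos: "\<epsilon> > 0" "\<delta> > 0"
    using \<eta> by (simp_all add: \<epsilon>_def \<delta>_def)
  obtain F where F: "finite F" "F \<noteq> {}" "F \<subseteq> carrier G"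
    "real (card {(f, s) \<in> F \<times> S. f \<otimes> s \<notin> F}) \<le> \<delta> * real (card F)"
    using folner[OF S(1,2) pos(2)] by blast
  show thesis
  proof (rule that[of "card F"])
    fix H assume H: "subgroup H G" "finite (rcosets H)"
    let ?m = "real (card (rcosets H))"
    obtain \<Lambda> :: "'a set \<Rightarrow> 'a set" where \<Lambda>: "\<forall>v. card {y \<in> rcosets H. \<Lambda> y = v} \<le> card F"
      "real (card {(y, s) \<in> (rcosets H) \<times> S. y #> s \<in> rcosets H \<and> \<Lambda> y \<noteq> \<Lambda> (y #> s)})
        \<le> 2 * (\<delta> / \<epsilon>) * ?m + real (card S) * \<epsilon> * ?m"
      using folner_partition[OF H F(1-3) S F(4) pos(2,1) subset_refl] by blast
    have "{(y, s) \<in> (rcosets H) \<times> S. y #> s \<in> rcosets H \<and> \<Lambda> y \<noteq> \<Lambda> (y #> s)}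
        = {(y, s) \<in> (rcosets H) \<times> S. \<Lambda> y \<noteq> \<Lambda> (y #> s)}"
      using rcosets_mult[OF H(1)] S by auto
    moreover have "2 * (\<delta> / \<epsilon>) + real (card S) * \<epsilon> \<le> \<eta>"
    proof -
      have "real (card S) * \<epsilon> = \<eta> / 2 * (real (card S) / (real (card S) + 1))"
        by (simp add: \<epsilon>_def)
      also have "\<dots> \<le> \<eta> / 2 * 1"
        using \<eta> by (intro mult_left_mono) auto
      finally show ?thesis
        using pos by (simp add: \<delta>_def)
    qed
    then have "(2 * (\<delta> / \<epsilon>) + real (card S) * \<epsilon>) * ?m \<le> \<eta> * ?m"
      by (intro mult_right_mono) auto
    ultimately show "\<exists>\<Lambda> :: 'a set \<Rightarrow> 'a set. (\<forall>v. card {y \<in> rcosets H. \<Lambda> y = v} \<le> card F) \<and>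
      real (card {(y, s) \<in> (rcosets H) \<times> S. \<Lambda> y \<noteq> \<Lambda> (y #> s)}) \<le> \<eta> * ?m"
      using \<Lambda> by (intro exI[of _ \<Lambda>]) (simp add: algebra_simps)
  qed
qed

section \<open>Subgroups of bounded index\<close>

context group
begin

lemma rcosets_self: "subgroup H G \<Longrightarrow> H \<in> rcosets H"
  using rcosetsI[of H \<one>] by (simp add: subgroup.subset)

text \<open>A subgroup is recorded by the Schreier graph on its cosets, labelled by numbers.\<close>

lemma finite_subgroups_of_bounded_index:
  assumes S: "finite S" "S \<subseteq> carrier G" "\<And>s. s \<in> S \<Longrightarrow> inv s \<in> S" "generate G S = carrier G"
  shows "finite {H. subgroup H G \<and> finite (rcosets H) \<and> card (rcosets H) \<le> M}"
proof -
  let ?A = "{H. subgroup H G \<and> finite (rcosets H) \<and> card (rcosets H) \<le> M}"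
  define f where "f H = (SOME f :: 'a set \<Rightarrow> nat. inj_on f (rcosets H) \<and> f ` (rcosets H) \<subseteq> {..<M})" for H
  have f: "inj_on (f H) (rcosets H)" "f H ` (rcosets H) \<subseteq> {..<M}" if "H \<in> ?A" for H
  proof -
    have "\<exists>f :: 'a set \<Rightarrow> nat. inj_on f (rcosets H) \<and> f ` (rcosets H) \<subseteq> {..<M}"
      using that card_le_inj[of "rcosets H" "{..<M}"] by auto
    then have "inj_on (f H) (rcosets H) \<and> f H ` (rcosets H) \<subseteq> {..<M}"
      unfolding f_def by (rule someI_ex)
    then show "inj_on (f H) (rcosets H)" "f H ` (rcosets H) \<subseteq> {..<M}"
      by auto
  qed
  \<comment> \<open>Base point and labelled edges of the Schreier graph. This determines
    \<open>H\<close>: an element lies in \<open>H\<close> iff the walk that it spells from the base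
    point is closed.\<close>
  define T where "T H = (f H H, {(f H Y, s, f H (Y #> s)) | Y s. Y \<in> rcosets H \<and> s \<in> S})" for H
  have "T ` ?A \<subseteq> {..<M} \<times> Pow ({..<M} \<times> S \<times> {..<M})"
  proof (rule image_subsetI)
    fix H assume H: "H \<in> ?A"
    have "f H Y < M" if "Y \<in> rcosets H" for Y
      using f(2)[OF H] that by auto
    moreover have "subgroup H G"
      using H by simp
    ultimately show "T H \<in> {..<M} \<times> Pow ({..<M} \<times> S \<times> {..<M})"
      using rcosets_self rcosets_mult S(2) by (auto simp: T_def subset_iff)
  qed
  then have "finite (T ` ?A)"
    by (rule finite_subset) (simp add: S(1))
  moreover have "inj_on T ?A"
  proof (rule inj_onI)
    fix H H' assume H: "H \<in> ?A" and H': "H' \<in> ?A" and eq: "T H = T H'"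
    have sub: "subgroup H G" "subgroup H' G"
      using H H' by auto
    note Hc = subgroup.subset[OF sub(1)] subgroup.subset[OF sub(2)]
    have same: "f H (H #> g) = f H' (H' #> g)" if g: "g \<in> carrier G" for g
    proof -
      have "f H (H #> (\<one> \<otimes> g)) = f H' (H' #> (\<one> \<otimes> g))"
      proof (rule generate_right_induct[OF S(2,3), where P = "\<lambda>x. f H (H #> x) = f H' (H' #> x)"])
        show "g \<in> generate G S"
          using g S(4) by simp
        show "f H (H #> \<one>) = f H' (H' #> \<one>)"
          using eq Hc by (simp add: T_def)
        fix x s assume x: "x \<in> carrier G" and s: "s \<in> S" and IH: "f H (H #> x) = f H' (H' #> x)"
        have sc: "s \<in> carrier G"
          using s S(2) by auto
        have "H #> x \<in> rcosets H"
          using x Hc by (intro rcosetsI)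
        then have "(f H (H #> x), s, f H ((H #> x) #> s)) \<in> snd (T H)"
          using s by (auto simp: T_def)
        then have "(f H (H #> x), s, f H ((H #> x) #> s)) \<in> snd (T H')"
          using eq by simp
        then obtain Y where Y: "Y \<in> rcosets H'" "f H' Y = f H (H #> x)" "f H' (Y #> s) = f H ((H #> x) #> s)"
          by (auto simp: T_def)
        have "H' #> x \<in> rcosets H'"
          using x Hc by (intro rcosetsI)
        then have "Y = H' #> x"
          using Y IH f(1)[OF H'] by (auto dest: inj_onD)
        then show "f H (H #> (x \<otimes> s)) = f H' (H' #> (x \<otimes> s))"
          using Y(3) x sc Hc by (simp add: coset_mult_assoc)
      qed simp_all
      then show ?thesis
        using g by simp
    qed
    have mem: "g \<in> K \<longleftrightarrow> f K (K #> g) = f K (K #> \<one>)" if K: "K \<in> ?A" and g: "g \<in> carrier G" for K g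
    proof -
      have K': "subgroup K G"
        using K by simp
      have "g \<in> K \<longleftrightarrow> K #> g = K #> \<one>"
        using g K' by (metis coset_join1 coset_join2 coset_mult_one subgroup.subset)
      also have "\<dots> \<longleftrightarrow> f K (K #> g) = f K (K #> \<one>)"
        using f(1)[OF K] g subgroup.subset[OF K'] by (simp add: inj_on_eq_iff rcosetsI del: coset_mult_one)
      finally show ?thesis .
    qed
    have "g \<in> H \<longleftrightarrow> g \<in> H'" if "g \<in> carrier G" for g
      unfolding mem[OF H that] mem[OF H' that] using same that by simp
    then show "H = H'"
      using Hc by blast
  qed
  ultimately show ?thesis
    by (rule finite_imageD)
qed

lemma min_generators_le:
  assumes "subgroup H G" "Gs \<subseteq> H" "finite Gs" "generate G Gs = H"
  shows "min_generators (G\<lparr>carrier := H\<rparr>) \<le> card Gs"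
  unfolding min_generators_def
  using assms by (intro Least_le exI[of _ Gs]) (simp add: generate_consistent[symmetric])

end

section \<open>Components and branches\<close>

lemma exit_edge:
  assumes "R\<^sup>*\<^sup>* x y" "x \<in> W" "y \<notin> W"
  shows "\<exists>a b. R a b \<and> a \<in> W \<and> b \<notin> W"
  using assms by (induction rule: rtranclp_induct) blast+

section \<open>Generators of groups acting on connected graphs\<close>

context group
begin

text \<open>A telescoping product. This is how connectedness of a graph is turned into generation of
  a group, once for free actions and once for the action of \<open>H\<close> on components.\<close>

lemma path_in_subgroup:
  assumes M: "subgroup M G" and path: "E\<^sup>*\<^sup>* x y"
    and car: "\<pi> x \<in> carrier G" "\<And>a b. E a b \<Longrightarrow> \<pi> b \<in> carrier G"
    and step: "\<And>a b. E a b \<Longrightarrow> inv (\<pi> a) \<otimes> \<pi> b \<in> M"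
  shows "inv (\<pi> x) \<otimes> \<pi> y \<in> M \<and> \<pi> y \<in> carrier G"
  using path
proof (induction rule: rtranclp_induct)
  case base
  then show ?case
    using car M by (simp add: subgroup.one_closed)
next
  case (step y z)
  have "inv (\<pi> x) \<otimes> \<pi> z = (inv (\<pi> x) \<otimes> \<pi> y) \<otimes> (inv (\<pi> y) \<otimes> \<pi> z)"
    using step car by (simp add: m_assoc)
  then show ?case
    using step.IH assms(5)[OF step.hyps(2)] car(2)[OF step.hyps(2)] M
    by (simp add: subgroup.m_closed)
qed

lemma subgroup_l_coset_stabilizer:
  assumes K: "subgroup K G" and B: "B \<subseteq> carrier G"
  shows "subgroup {h \<in> K. h <# B = B} G"
proof -
  have Kc: "h \<in> carrier G" if "h \<in> K" for h
    using K that by (simp add: subgroup.mem_carrier)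
  show ?thesis
  proof (rule subgroupI)
    show "{h \<in> K. h <# B = B} \<noteq> {}"
      using K B lcos_mult_one subgroup.one_closed by blast
    fix a assume a: "a \<in> {h \<in> K. h <# B = B}"
    have "inv a <# (a <# B) = B"
      using a Kc[of a] B by (subst lcos_m_assoc) (auto simp: lcos_mult_one)
    then show "inv a \<in> {h \<in> K. h <# B = B}"
      using a K by (simp add: subgroup.m_inv_closed)
    fix b assume b: "b \<in> {h \<in> K. h <# B = B}"
    then show "a \<otimes> b \<in> {h \<in> K. h <# B = B}"
      using a Kc B K by (simp add: lcos_m_assoc[symmetric] subgroup.m_closed)
  qed (use Kc in auto)
qed

text \<open>\<open>\<kappa>\<close> names the orbits. Each vertex \<open>w\<close> is
  \<open>\<pi> w\<close> applied to the representative of its orbit, and by freeness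
  \<open>\<pi>\<close> is equivariant. The generators are the values of \<open>\<pi>\<close> at the
  neighbours of the representatives: any edge can be translated to start at a representative, so the
  increments of \<open>\<pi>\<close> along edges are generators.\<close>

lemma generators_from_free_action:
  fixes act :: "'a \<Rightarrow> 'w \<Rightarrow> 'w" and \<kappa> :: "'w \<Rightarrow> 'k"
  assumes C: "subgroup C G"
    and act: "\<And>c w. c \<in> C \<Longrightarrow> w \<in> \<Omega> \<Longrightarrow> act c w \<in> \<Omega>"
      "\<And>c d w. c \<in> C \<Longrightarrow> d \<in> C \<Longrightarrow> w \<in> \<Omega> \<Longrightarrow> act (c \<otimes> d) w = act c (act d w)"
      "\<And>w. w \<in> \<Omega> \<Longrightarrow> act \<one> w = w"
    and free: "\<And>c w. c \<in> C \<Longrightarrow> w \<in> \<Omega> \<Longrightarrow> act c w = w \<Longrightarrow> c = \<one>"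
    and E: "\<And>c w w'. c \<in> C \<Longrightarrow> w \<in> \<Omega> \<Longrightarrow> w' \<in> \<Omega> \<Longrightarrow> E w w' \<Longrightarrow> E (act c w) (act c w')"
    and conn: "\<And>w w'. w \<in> \<Omega> \<Longrightarrow> w' \<in> \<Omega> \<Longrightarrow> (\<lambda>a b. a \<in> \<Omega> \<and> b \<in> \<Omega> \<and> E a b)\<^sup>*\<^sup>* w w'"
    and key: "finite (\<kappa> ` \<Omega>)" "\<And>w w'. w \<in> \<Omega> \<Longrightarrow> w' \<in> \<Omega> \<Longrightarrow> \<kappa> w = \<kappa> w' \<Longrightarrow> \<exists>c\<in>C. w' = act c w"
      "\<And>c w. c \<in> C \<Longrightarrow> w \<in> \<Omega> \<Longrightarrow> \<kappa> (act c w) = \<kappa> w"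
    and nbrs: "\<And>w. w \<in> \<Omega> \<Longrightarrow> finite {w' \<in> \<Omega>. E w w'} \<and> card {w' \<in> \<Omega>. E w w'} \<le> D"
    and ne: "\<Omega> \<noteq> {}"
  shows "\<exists>Gs \<subseteq> C. finite Gs \<and> card Gs \<le> card (\<kappa> ` \<Omega>) * D \<and> generate G Gs = C"
proof -
  have Cc: "c \<in> carrier G" if "c \<in> C" for c
    using C that by (simp add: subgroup.mem_carrier)
  define rep where "rep k = (SOME w. w \<in> \<Omega> \<and> \<kappa> w = k)" for k
  have rep: "rep (\<kappa> w) \<in> \<Omega>" "\<kappa> (rep (\<kappa> w)) = \<kappa> w" if "w \<in> \<Omega>" for w
  proof -
    have "rep (\<kappa> w) \<in> \<Omega> \<and> \<kappa> (rep (\<kappa> w)) = \<kappa> w"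
      unfolding rep_def by (rule someI[of _ w]) (use that in auto)
    then show "rep (\<kappa> w) \<in> \<Omega>" "\<kappa> (rep (\<kappa> w)) = \<kappa> w"
      by auto
  qed
  define \<pi> where "\<pi> w = (SOME c. c \<in> C \<and> w = act c (rep (\<kappa> w)))" for w
  have \<pi>: "\<pi> w \<in> C" "act (\<pi> w) (rep (\<kappa> w)) = w" if "w \<in> \<Omega>" for w
  proof -
    have "\<exists>c. c \<in> C \<and> w = act c (rep (\<kappa> w))"
      using key(2)[OF rep(1)[OF that] that rep(2)[OF that]] by blast
    then have "\<pi> w \<in> C \<and> w = act (\<pi> w) (rep (\<kappa> w))"
      unfolding \<pi>_def by (rule someI_ex)
    then show "\<pi> w \<in> C" "act (\<pi> w) (rep (\<kappa> w)) = w"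
      by auto
  qed
  have uniq: "c = d" if "c \<in> C" "d \<in> C" "w \<in> \<Omega>" "act c w = act d w" for c d w
  proof -
    have i: "inv d \<in> C" "inv d \<otimes> c \<in> C"
      using that C by (simp_all add: subgroup.m_inv_closed subgroup.m_closed)
    have "act (inv d \<otimes> c) w = act (inv d \<otimes> d) w"
      using that i act by simp
    then have "act (inv d \<otimes> c) w = w"
      using that act Cc by simp
    then have "inv d \<otimes> c = \<one>"
      using free that i by blast
    then show ?thesis
      using that Cc by (metis inv_closed inv_equality inv_inv)
  qed
  have equiv: "\<pi> (act c w) = c \<otimes> \<pi> w" if "c \<in> C" "w \<in> \<Omega>" for c w
  proof (rule uniq)
    show "act (\<pi> (act c w)) (rep (\<kappa> w)) = act (c \<otimes> \<pi> w) (rep (\<kappa> w))"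
      using \<pi>[of w] \<pi>[of "act c w"] that act rep key by simp
  qed (use \<pi> act that rep C in \<open>auto simp: subgroup.m_closed\<close>)
  define Gs where "Gs = (\<Union>k\<in>\<kappa> ` \<Omega>. \<pi> ` {w' \<in> \<Omega>. E (rep k) w'})"
  have GsC: "Gs \<subseteq> C"
    using \<pi> by (auto simp: Gs_def)
  moreover have "finite Gs"
    unfolding Gs_def using nbrs rep by (intro finite_UN_I key(1) finite_imageI) auto
  moreover have "card Gs \<le> card (\<kappa> ` \<Omega>) * D"
  proof -
    have "card Gs \<le> (\<Sum>k\<in>\<kappa> ` \<Omega>. card (\<pi> ` {w' \<in> \<Omega>. E (rep k) w'}))"
      unfolding Gs_def using key by (intro card_UN_le)
    also have "\<dots> \<le> (\<Sum>k\<in>\<kappa> ` \<Omega>. D)"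
    proof (rule sum_mono)
      fix k assume "k \<in> \<kappa> ` \<Omega>"
      then have "rep k \<in> \<Omega>"
        using rep by auto
      then show "card (\<pi> ` {w' \<in> \<Omega>. E (rep k) w'}) \<le> D"
        using nbrs by (meson card_image_le le_trans)
    qed
    finally show ?thesis
      by simp
  qed
  moreover have "generate G Gs = C"
  proof
    show "generate G Gs \<subseteq> C"
      using GsC C by (rule generate_subgroup_incl)
    have M: "subgroup (generate G Gs) G"
      using GsC Cc by (intro generate_is_subgroup) auto
    obtain w where w: "w \<in> \<Omega>"
      using ne by blast
    have step: "inv (\<pi> a) \<otimes> \<pi> b \<in> generate G Gs" if ab: "a \<in> \<Omega>" "b \<in> \<Omega>" "E a b" for a b
    proof -
      have i: "inv (\<pi> a) \<in> C"
        using \<pi> ab C by (simp add: subgroup.m_inv_closed)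
      have "act (inv (\<pi> a)) a = act (inv (\<pi> a)) (act (\<pi> a) (rep (\<kappa> a)))"
        using \<pi> ab by simp
      also have "\<dots> = act (inv (\<pi> a) \<otimes> \<pi> a) (rep (\<kappa> a))"
        using \<pi>(1) i rep(1) ab act(2) by metis
      also have "\<dots> = rep (\<kappa> a)"
        using \<pi> ab rep act Cc by simp
      finally have "E (rep (\<kappa> a)) (act (inv (\<pi> a)) b)"
        using E[OF i ab] by simp
      then have "\<pi> (act (inv (\<pi> a)) b) \<in> Gs"
        unfolding Gs_def using ab i act by blast
      then show ?thesis
        using equiv[OF i] ab by (simp add: generate.incl)
    qed
    show "C \<subseteq> generate G Gs"
    proof
      fix c assume c: "c \<in> C"
      \<comment> \<open>The value \<open>\<pi> w\<close> need not be \<open>\<one>\<close>;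
        conjugating by it makes the increment of \<open>\<pi>\<close> from \<open>w\<close> to
        \<open>act d w\<close> equal to \<open>c\<close> itself.\<close>
      define d where "d = \<pi> w \<otimes> c \<otimes> inv (\<pi> w)"
      have d: "d \<in> C"
        using c w \<pi> C by (simp add: d_def subgroup.m_closed subgroup.m_inv_closed)
      have "inv (\<pi> w) \<otimes> \<pi> (act d w) \<in> generate G Gs"
        using path_in_subgroup[OF M conn[OF w act(1)[OF d w]], of \<pi>] step \<pi> Cc w by blast
      moreover have "inv (\<pi> w) \<otimes> \<pi> (act d w) = c"
        using equiv[OF d w] c w \<pi> Cc by (simp add: d_def m_assoc)
      ultimately show "c \<in> generate G Gs"
        by simp
    qed
  qed
  ultimately show ?thesis
    by blast
qed

end

text \<open>In the application \<open>lab x\<close> names the piece of the Schreier graph that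
  contains \<open>H #> x\<close>; the invariance lets \<open>H\<close> permute the components of the
  lift.\<close>

locale colored_cayley = mean G \<mu> for G (structure) and \<mu> +
  fixes S H and lab :: "'a \<Rightarrow> 'l"
  assumes S: "finite S" "S \<subseteq> carrier G" "\<And>s. s \<in> S \<Longrightarrow> inv s \<in> S"
    and S_gen: "generate G S = carrier G"
    and S_sc: "simply_connected S"
    and H: "subgroup H G" "finite (rcosets H)"
    and lab: "\<And>h x. h \<in> H \<Longrightarrow> x \<in> carrier G \<Longrightarrow> lab (h \<otimes> x) = lab x"
begin

abbreviation ad :: "'a \<Rightarrow> 'a \<Rightarrow> bool" where "ad \<equiv> adj S"

definition mono_adj :: "'a \<Rightarrow> 'a \<Rightarrow> bool" where
  "mono_adj x y \<longleftrightarrow> ad x y \<and> lab x = lab y"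

text \<open>A component may be infinite even if the pieces below are bounded; what is then bounded
  is the number of cosets of \<open>H\<close> that it meets.\<close>

definition component :: "'a \<Rightarrow> 'a set" where
  "component x = {y. mono_adj\<^sup>*\<^sup>* x y}"

definition outside :: "'a set \<Rightarrow> 'a \<Rightarrow> 'a \<Rightarrow> bool" where
  "outside v x y \<longleftrightarrow> ad x y \<and> x \<notin> v \<and> y \<notin> v"

text \<open>For \<open>x\<close> outside \<open>v\<close> this is a connected component of the
  complement of \<open>v\<close>; for \<open>x\<close> in \<open>v\<close> it is the meaningless
  value \<open>{x}\<close>.\<close>

definition branch :: "'a set \<Rightarrow> 'a \<Rightarrow> 'a set" where
  "branch v x = {y. (outside v)\<^sup>*\<^sup>* x y}"

definition stab :: "'a \<Rightarrow> 'a set" where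
  "stab x = {h \<in> H. h <# component x = component x}"

text \<open>The edges leaving the component, taken modulo \<open>H\<close>: coset and generator
  identify the \<open>H\<close>-orbit of an edge, and the set stays finite for an infinite
  component.\<close>

definition cross :: "'a \<Rightarrow> ('a set \<times> 'a) set" where
  "cross x = {(H #> y, s) | y s. y \<in> component x \<and> s \<in> S \<and> lab y \<noteq> lab (y \<otimes> s)}"

definition cross_edges :: "('a set \<times> 'a) set" where
  "cross_edges = {(H #> y, s) | y s. y \<in> carrier G \<and> s \<in> S \<and> lab y \<noteq> lab (y \<otimes> s)}"

lemma Hc: "h \<in> H \<Longrightarrow> h \<in> carrier G"
  using H by (simp add: subgroup.mem_carrier)

lemma ad_carrier: "ad x y \<Longrightarrow> x \<in> carrier G" "ad x y \<Longrightarrow> y \<in> carrier G"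
  by (auto simp: adj_def)

lemma ad_sym: "ad x y \<Longrightarrow> ad y x"
  using adj_sym S by blast

lemma ad_connected:
  assumes "x \<in> carrier G" "y \<in> carrier G"
  shows "ad\<^sup>*\<^sup>* x y"
proof -
  have gen: "inv x \<otimes> y \<in> generate G S"
    using assms S_gen by simp
  have "ad\<^sup>*\<^sup>* x (x \<otimes> (inv x \<otimes> y))"
    by (rule generate_right_induct[OF S(2) _ gen, where P = "ad\<^sup>*\<^sup>* x"])
      (use assms S(3) adj_mult_right[OF S(2)] in \<open>auto intro: rtranclp.rtrancl_into_rtrancl\<close>)
  then show ?thesis
    using assms by simp
qed

lemma mono_sym: "mono_adj x y \<Longrightarrow> mono_adj y x"
  by (simp add: mono_adj_def ad_sym)

lemma mono_rtrancl_sym: "mono_adj\<^sup>*\<^sup>* x y \<Longrightarrow> mono_adj\<^sup>*\<^sup>* y x"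
  by (metis mono_sym symp_rtranclp sympD sympI)

lemma mono_left:
  assumes "h \<in> H" "mono_adj x y"
  shows "mono_adj (h \<otimes> x) (h \<otimes> y)"
  using assms adj_mult_left[OF Hc] ad_carrier lab by (auto simp: mono_adj_def)

lemma component_carrier: "x \<in> carrier G \<Longrightarrow> component x \<subseteq> carrier G"
proof
  fix y assume x: "x \<in> carrier G" and "y \<in> component x"
  then have "mono_adj\<^sup>*\<^sup>* x y"
    by (simp add: component_def)
  then show "y \<in> carrier G"
    using x by (induction rule: rtranclp_induct) (auto simp: mono_adj_def ad_carrier)
qed

lemma component_self [simp]: "x \<in> component x"
  by (simp add: component_def)

lemma component_eq: "y \<in> component x \<Longrightarrow> component y = component x"
  unfolding component_def using mono_rtrancl_sym by (auto intro: rtranclp_trans)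

lemma component_sym: "y \<in> component x \<Longrightarrow> x \<in> component y"
  using component_eq component_self by blast

lemma component_step: "y \<in> component x \<Longrightarrow> mono_adj y z \<Longrightarrow> z \<in> component x"
  by (simp add: component_def)

lemma component_lab: "y \<in> component x \<Longrightarrow> lab y = lab x"
proof -
  assume "y \<in> component x"
  then have "mono_adj\<^sup>*\<^sup>* x y"
    by (simp add: component_def)
  then show ?thesis
    by (induction rule: rtranclp_induct) (auto simp: mono_adj_def)
qed

lemma component_left:
  assumes "h \<in> H" "y \<in> component x"
  shows "h \<otimes> y \<in> component (h \<otimes> x)"
proof -
  have "mono_adj\<^sup>*\<^sup>* x y"
    using assms by (simp add: component_def)
  then have "mono_adj\<^sup>*\<^sup>* (h \<otimes> x) (h \<otimes> y)"
    by (induction rule: rtranclp_induct) (auto intro: rtranclp.rtrancl_into_rtrancl mono_left assms)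
  then show ?thesis
    by (simp add: component_def)
qed

lemma component_l_coset:
  assumes "h \<in> H" "x \<in> carrier G"
  shows "h <# component x = component (h \<otimes> x)"
proof
  show "h <# component x \<subseteq> component (h \<otimes> x)"
    using assms component_left by (auto simp: l_coset_def)
  show "component (h \<otimes> x) \<subseteq> h <# component x"
  proof
    fix y assume y: "y \<in> component (h \<otimes> x)"
    then have yc: "y \<in> carrier G"
      using assms Hc component_carrier by (meson m_closed subsetD)
    have "inv h \<otimes> y \<in> component (inv h \<otimes> (h \<otimes> x))"
      using assms y H by (intro component_left) (auto simp: subgroup.m_inv_closed)
    then have "inv h \<otimes> y \<in> component x"
      using assms Hc by simp
    then show "y \<in> h <# component x"
      using yc assms Hc by (force simp: l_coset_def)
  qed
qed

lemma stab_iff: "x \<in> carrier G \<Longrightarrow> h \<in> stab x \<longleftrightarrow> h \<in> H \<and> h \<otimes> x \<in> component x"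
  using component_l_coset component_eq component_self by (auto simp: stab_def)

lemma subgroup_stab: "x \<in> carrier G \<Longrightarrow> subgroup (stab x) G"
  unfolding stab_def using H component_carrier by (intro subgroup_l_coset_stabilizer)

lemma outside_sym: "outside v x y \<Longrightarrow> outside v y x"
  by (simp add: outside_def ad_sym)

lemma branch_self [simp]: "x \<in> branch v x"
  by (simp add: branch_def)

lemma branch_eq: "y \<in> branch v x \<Longrightarrow> branch v y = branch v x"
proof -
  have "(outside v)\<^sup>*\<^sup>* y x" if "(outside v)\<^sup>*\<^sup>* x y" for x y
    using that by (metis outside_sym symp_rtranclp sympD sympI)
  then show "y \<in> branch v x \<Longrightarrow> ?thesis"
    unfolding branch_def by (auto intro: rtranclp_trans)
qed

lemma branch_step: "y \<in> branch v x \<Longrightarrow> outside v y z \<Longrightarrow> z \<in> branch v x"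
  by (simp add: branch_def)

lemma branch_subset:
  assumes "x \<in> carrier G - v"
  shows "branch v x \<subseteq> carrier G - v"
proof
  fix y assume "y \<in> branch v x"
  then have "(outside v)\<^sup>*\<^sup>* x y"
    by (simp add: branch_def)
  then show "y \<in> carrier G - v"
    using assms by (induction rule: rtranclp_induct) (auto simp: outside_def ad_carrier)
qed

lemma branch_closed:
  assumes "x \<in> carrier G - v" "y \<in> branch v x" "ad y z" "z \<notin> v"
  shows "z \<in> branch v x"
  using assms branch_subset[OF assms(1)] branch_step[of y v x z] by (auto simp: outside_def)

lemma branch_l_coset_subset:
  assumes "h \<in> carrier G" "v \<subseteq> carrier G" "x \<in> carrier G"
  shows "h <# branch v x \<subseteq> branch (h <# v) (h \<otimes> x)"
proof -
  have *: "h \<otimes> y \<notin> h <# v" if "y \<in> carrier G" "y \<notin> v" for y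
    using that assms by (auto simp: l_coset_def)
  have "(outside (h <# v))\<^sup>*\<^sup>* (h \<otimes> x) (h \<otimes> y)" if "(outside v)\<^sup>*\<^sup>* x y" for y
    using that
  proof (induction rule: rtranclp_induct)
    case (step y z)
    then have "outside (h <# v) (h \<otimes> y) (h \<otimes> z)"
      using * assms adj_mult_left ad_carrier by (auto simp: outside_def)
    with step.IH show ?case
      by (rule rtranclp.rtrancl_into_rtrancl)
  qed simp
  then show ?thesis
    by (auto simp: branch_def l_coset_def)
qed

lemma branch_l_coset:
  assumes "h \<in> carrier G" "v \<subseteq> carrier G" "x \<in> carrier G - v"
  shows "h <# branch v x = branch (h <# v) (h \<otimes> x)"
proof
  show "h <# branch v x \<subseteq> branch (h <# v) (h \<otimes> x)"
    using assms by (intro branch_l_coset_subset) auto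
  have hx: "h \<otimes> x \<in> carrier G - (h <# v)"
    using assms by (auto simp: l_coset_def)
  have "inv h <# branch (h <# v) (h \<otimes> x) \<subseteq> branch (inv h <# (h <# v)) (inv h \<otimes> (h \<otimes> x))"
    using assms by (intro branch_l_coset_subset l_coset_subset_G) auto
  then have *: "inv h <# branch (h <# v) (h \<otimes> x) \<subseteq> branch v x"
    using assms by (simp add: lcos_m_assoc lcos_mult_one)
  show "branch (h <# v) (h \<otimes> x) \<subseteq> h <# branch v x"
  proof
    fix y assume y: "y \<in> branch (h <# v) (h \<otimes> x)"
    then have "inv h \<otimes> y \<in> branch v x"
      using * by (auto simp: l_coset_def)
    moreover have "y = h \<otimes> (inv h \<otimes> y)"
      using y branch_subset[OF hx] assms by auto
    ultimately show "y \<in> h <# branch v x"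
      unfolding l_coset_def by blast
  qed
qed

text \<open>A path from \<open>y\<close> to \<open>g\<close> has to leave the branch, and by
  \<open>branch_closed\<close> it can do so only into the component.\<close>

lemma branch_has_edge:
  assumes "g \<in> carrier G" "y \<in> carrier G - component g"
  shows "\<exists>a b. a \<in> component g \<and> b \<in> branch (component g) y \<and> ad a b"
proof -
  have "g \<notin> branch (component g) y"
    using branch_subset[OF assms(2)] by auto
  then obtain b a where "ad b a" "b \<in> branch (component g) y" "a \<notin> branch (component g) y"
    using exit_edge[OF ad_connected[of y g], of "branch (component g) y"] assms by auto
  then show ?thesis
    using branch_closed[OF assms(2)] ad_sym by blast
qed

text \<open>The threshold \<open>1 / 3\<close> serves two purposes: two branches of mean at most
  \<open>1 / 3\<close> cannot cover the group, and three disjoint translates of a branch of larger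
  mean do not fit into it.\<close>

definition central :: "'a \<Rightarrow> bool" where
  "central g \<longleftrightarrow> (\<forall>y \<in> carrier G - component g. \<mu> (branch (component g) y) \<le> 1 / 3)"

text \<open>
  If \<open>h\<close> moved a central component \<open>v\<close>, then the branch at \<open>v\<close> containing \<open>h v\<close> and the branch at
  \<open>h v\<close> containing \<open>v\<close> would cover the group, while each has mean at most \<open>1/3\<close>.
\<close>

lemma central_fixed:
  assumes g: "g \<in> carrier G" and cen: "central g" and h: "h \<in> H"
  shows "h \<in> stab g"
proof (rule ccontr)
  assume "h \<notin> stab g"
  then have "h \<otimes> g \<notin> component g"
    using g h by (simp add: stab_iff)
  define v where "v = component g"
  define w where "w = component (h \<otimes> g)"
  have w_eq: "w = h <# v"
    using component_l_coset g h by (simp add: v_def w_def)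
  have car: "h \<in> carrier G" "h \<otimes> g \<in> carrier G" "v \<subseteq> carrier G" "w \<subseteq> carrier G"
    using g h Hc component_carrier by (auto simp: v_def w_def)
  have disj: "v \<inter> w = {}"
    using \<open>h \<otimes> g \<notin> component g\<close> component_eq component_self unfolding v_def w_def by blast
  have in_self: "g \<in> v" "h \<otimes> g \<in> w"
    by (simp_all add: v_def w_def)
  have hg: "h \<otimes> g \<in> carrier G - v" and gw: "g \<in> carrier G - w"
    using car g disj in_self by auto
  define B where "B = branch v (h \<otimes> g)"
  define B' where "B' = branch w g"
  have Bsub: "B \<subseteq> carrier G - v" and B'sub: "B' \<subseteq> carrier G - w"
    using branch_subset hg gw by (auto simp: B_def B'_def)
  \<comment> \<open>A component that avoids \<open>u\<close> is connected in the complement of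
    \<open>u\<close>, hence lies in a single branch at \<open>u\<close>.\<close>
  have connect: "component x \<subseteq> branch u x" if "component x \<inter> u = {}" for x u
  proof
    fix y assume "y \<in> component x"
    then have "mono_adj\<^sup>*\<^sup>* x y"
      by (simp add: component_def)
    then have "y \<in> branch u x \<and> y \<in> component x"
    proof (induction rule: rtranclp_induct)
      case (step y z)
      then have "z \<in> component x"
        using component_step by blast
      then have "outside u y z"
        using step that by (auto simp: outside_def mono_adj_def)
      then show ?case
        using step branch_step \<open>z \<in> component x\<close> by blast
    qed simp
    then show "y \<in> branch u x"
      by blast
  qed
  have wB: "w \<subseteq> B" and vB': "v \<subseteq> B'"
    unfolding B_def B'_def using disj connect[of "h \<otimes> g" v] connect[of g w]
    by (auto simp: v_def w_def)
  \<comment> \<open>A point \<open>z\<close> outside \<open>B\<close> and \<open>v\<close> lies in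
    another branch at \<open>v\<close>. That branch misses \<open>w\<close>, which is inside
    \<open>B\<close>, and has an edge to \<open>v\<close>; so it is joined to \<open>v\<close> in
    the complement of \<open>w\<close> and lies in \<open>B'\<close>.\<close>
  have "carrier G \<subseteq> B \<union> B'"
  proof
    fix z assume z: "z \<in> carrier G"
    show "z \<in> B \<union> B'"
    proof (cases "z \<in> B \<or> z \<in> v")
      case False
      then have zv: "z \<in> carrier G - component g"
        using z by (simp add: v_def)
      have Zw: "branch v z \<inter> w = {}"
      proof (rule ccontr)
        assume "branch v z \<inter> w \<noteq> {}"
        then obtain u where "u \<in> branch v z" "u \<in> B"
          using wB by blast
        then have "branch v z = B"
          using branch_eq unfolding B_def by metis
        then show False
          using False branch_self[of z v] by blast
      qed
      obtain a b where ab: "a \<in> v" "b \<in> branch v z" "ad a b"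
        using branch_has_edge[OF g zv] by (auto simp: v_def)
      have "outside w a b"
        using ab Zw disj by (auto simp: outside_def)
      then have "b \<in> B'"
        using vB' ab branch_step by (auto simp: B'_def)
      have "(outside v)\<^sup>*\<^sup>* b z"
        using branch_eq[OF ab(2)] branch_self[of z v] by (auto simp: branch_def)
      then have "z \<in> B' \<and> z \<in> branch v b"
      proof (induction rule: rtranclp_induct)
        case base
        then show ?case
          using \<open>b \<in> B'\<close> by simp
      next
        case (step y x)
        then have "x \<in> branch v b"
          using branch_step by blast
        then have "outside w y x"
          using step Zw branch_eq[OF ab(2)] by (auto simp: outside_def)
        then show ?case
          using step branch_step \<open>x \<in> branch v b\<close> by (auto simp: B'_def)
      qed
      then show ?thesis
        by blast
    qed (use vB' in auto)
  qed
  have third: "\<mu> B \<le> 1 / 3"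
    using cen hg by (simp add: central_def v_def B_def)
  \<comment> \<open>Centrality concerns branches at \<open>v\<close>, but \<open>B'\<close> is a
    branch at \<open>w\<close>; it is the translate by \<open>h\<close> of the branch at
    \<open>v\<close> containing \<open>inv h \<otimes> g\<close>.\<close>
  have "inv h \<otimes> g \<notin> v"
  proof
    assume "inv h \<otimes> g \<in> v"
    then have "h \<otimes> (inv h \<otimes> g) \<in> w"
      unfolding w_eq l_coset_def by blast
    then show False
      using gw car g by simp
  qed
  then have "inv h \<otimes> g \<in> carrier G - v"
    using car g by simp
  have "\<mu> (branch v (inv h \<otimes> g)) \<le> 1 / 3"
    using cen \<open>inv h \<otimes> g \<in> carrier G - v\<close> by (simp add: central_def v_def)
  moreover have "h <# branch v (inv h \<otimes> g) = B'"
    using branch_l_coset[OF car(1,3) \<open>inv h \<otimes> g \<in> carrier G - v\<close>] car g by (simp add: B'_def w_eq)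
  moreover have "branch v (inv h \<otimes> g) \<subseteq> carrier G"
    using branch_subset[OF \<open>inv h \<otimes> g \<in> carrier G - v\<close>] by blast
  ultimately have third': "\<mu> B' \<le> 1 / 3"
    using mean_l_coset[OF car(1), of "branch v (inv h \<otimes> g)"] by simp
  have "1 \<le> \<mu> (B \<union> B')"
    using mean_mono[OF \<open>carrier G \<subseteq> B \<union> B'\<close>] Bsub B'sub mean_carrier by auto
  also have "\<dots> \<le> \<mu> B + \<mu> B'"
    using Bsub B'sub by (intro mean_Un_le) auto
  finally show False
    using third third' by simp
qed

end

section \<open>Edge cuts and the ranks of component stabilisers\<close>

context colored_cayley
begin

lemma r_coset_eqE:
  assumes "x \<in> carrier G" "y \<in> carrier G" "H #> x = H #> y"
  obtains h where "h \<in> H" "y = h \<otimes> x"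
proof -
  have "y \<in> H #> x"
    using rcos_self[OF assms(2) H(1)] assms(3) by simp
  then show thesis
    using that by (auto simp: r_coset_def)
qed

lemma r_coset_left: "h \<in> H \<Longrightarrow> x \<in> carrier G \<Longrightarrow> H #> (h \<otimes> x) = H #> x"
  using H Hc by (metis coset_join2 coset_mult_assoc subgroup.subset)

lemma cross_subset: "x \<in> carrier G \<Longrightarrow> cross x \<subseteq> cross_edges"
  using component_carrier by (auto simp: cross_def cross_edges_def)

lemma finite_cross_edges: "finite cross_edges"
proof (rule finite_subset)
  show "cross_edges \<subseteq> (rcosets H) \<times> S"
    by (auto simp: cross_edges_def RCOSETS_def)
qed (use H S in simp)

lemma finite_cross: "x \<in> carrier G \<Longrightarrow> finite (cross x)"
  using cross_subset finite_cross_edges finite_subset by metis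

definition edge_cut :: "'a set \<Rightarrow> 'a set \<Rightarrow> ('a \<times> 'a) set" where
  "edge_cut v B = {(x, y). x \<in> v \<and> y \<in> B \<and> ad x y}"

text \<open>For two edges of a cut this means being two sides of a filled triangle whose third side
  does not cross the cut.\<close>

definition cut_adj :: "'a \<times> 'a \<Rightarrow> 'a \<times> 'a \<Rightarrow> bool" where
  "cut_adj e f \<longleftrightarrow> fst e = fst f \<and> ad (snd e) (snd f) \<or> snd e = snd f \<and> ad (fst e) (fst f)"

text \<open>
  The indicator function of a class of triangle-connected edges of the edge_cut is a cocycle; it is the
  coboundary of a function which is constant on either side of the edge_cut.
\<close>

lemma cut_connected:
  assumes g: "g \<in> carrier G" and y: "y \<in> carrier G - component g"
    and e: "e \<in> edge_cut (component g) (branch (component g) y)" and f: "f \<in> edge_cut (component g) (branch (component g) y)"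
  shows "(\<lambda>a b. a \<in> edge_cut (component g) (branch (component g) y) \<and> b \<in> edge_cut (component g) (branch (component g) y) \<and> cut_adj a b)\<^sup>*\<^sup>* e f"
proof -
  define v where "v = component g"
  define B where "B = branch v y"
  define \<Omega> where "\<Omega> = edge_cut v B"
  define D where "D = {f. (\<lambda>a b. a \<in> \<Omega> \<and> b \<in> \<Omega> \<and> cut_adj a b)\<^sup>*\<^sup>* e f}"
  have e': "e \<in> \<Omega>" and f': "f \<in> \<Omega>"
    using e f by (auto simp: \<Omega>_def v_def B_def)
  have disj: "z \<notin> B" if "z \<in> v" for z
    using branch_subset[OF y] that by (auto simp: v_def B_def)
  have closed: "b \<in> B" if "a \<in> B" "ad a b" "b \<notin> v" for a b
    using branch_closed[OF y] that by (simp add: v_def B_def)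
  have D_sub: "D \<subseteq> \<Omega>"
  proof
    fix p assume "p \<in> D"
    then have "(\<lambda>a b. a \<in> \<Omega> \<and> b \<in> \<Omega> \<and> cut_adj a b)\<^sup>*\<^sup>* e p"
      by (simp add: D_def)
    then show "p \<in> \<Omega>"
      using e' by (induction rule: rtranclp_induct) auto
  qed
  have D_step: "q \<in> D" if "p \<in> D" "q \<in> \<Omega>" "cut_adj p q" for p q
    using that D_sub unfolding D_def by (auto intro: rtranclp.rtrancl_into_rtrancl)
  have DB: "a \<in> v" "b \<in> B" "ad a b" if "(a, b) \<in> D" for a b
    using D_sub that by (auto simp: \<Omega>_def edge_cut_def)
  have D1: "(a, b) \<in> D \<longleftrightarrow> (a, b') \<in> D" if "a \<in> v" "b \<in> B" "b' \<in> B" "ad a b" "ad a b'" "ad b b'" for a b b'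
    using D_step[of "(a, b)" "(a, b')"] D_step[of "(a, b')" "(a, b)"] that ad_sym
    by (auto simp: \<Omega>_def edge_cut_def cut_adj_def)
  have D2: "(a, b) \<in> D \<longleftrightarrow> (a', b) \<in> D" if "a \<in> v" "a' \<in> v" "b \<in> B" "ad a b" "ad a' b" "ad a a'" for a a' b
    using D_step[of "(a, b)" "(a', b)"] D_step[of "(a', b)" "(a, b)"] that ad_sym
    by (auto simp: \<Omega>_def edge_cut_def cut_adj_def)
  \<comment> \<open>\<open>D\<close> consists of edges oriented from \<open>v\<close> to
    \<open>B\<close>; the cochain is symmetrised because the vertices of a triangle may come in any
    order.\<close>
  define c where "c a b \<longleftrightarrow> (a, b) \<in> D \<or> (b, a) \<in> D" for a b
  have c_sym: "c a b = c b a" for a b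
    by (auto simp: c_def)
  have c_out: "\<not> c a b" if "a \<notin> v" "b \<notin> v" for a b
    using that DB by (auto simp: c_def)
  have c_in: "\<not> c a b" if "a \<notin> B" "b \<notin> B" for a b
    using that DB by (auto simp: c_def)
  have c_vB: "c a b \<longleftrightarrow> (a, b) \<in> D" if "a \<in> v" for a b
    using that DB(2)[of b a] disj[of a] by (auto simp: c_def)
  \<comment> \<open>A triangle meeting both \<open>v\<close> and \<open>B\<close> has its third
    vertex in one of them, as a branch has no edges to other branches. Exactly two of its sides lie
    in the cut and \<open>cut_adj\<close> relates them, so both or neither belong to
    \<open>D\<close>.\<close>
  have tri0: "c a z \<longleftrightarrow> c b z" if "a \<in> v" "z \<in> B" "ad a b" "ad b z" "ad a z" "b \<in> v" for a b z
    using that D2[of a b z] c_vB by auto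
  have tri1: "c a z \<longleftrightarrow> c a b" if "a \<in> v" "z \<in> B" "ad a b" "ad b z" "ad a z" "b \<in> B" for a b z
    using that D1[of a z b] c_vB ad_sym by auto
  have tri_vB: "c a z = (c a b \<noteq> c b z)" if "a \<in> v" "z \<in> B" "ad a b" "ad b z" "ad a z" for a b z
  proof (cases "b \<in> v")
    case True
    then show ?thesis
      using tri0[OF that] c_in[of a b] disj that by auto
  next
    case False
    then have "b \<in> B"
      using closed[of z b] that ad_sym by blast
    then show ?thesis
      using tri1[OF that] c_out[of b z] disj that by auto
  qed
  have "\<forall>a b z. ad a b \<longrightarrow> ad b z \<longrightarrow> ad a z \<longrightarrow> c a z = (c a b \<noteq> c b z)"
  proof (intro allI impI)
    fix a b z assume ads: "ad a b" "ad b z" "ad a z"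
    note s = ad_sym[OF ads(1)] ad_sym[OF ads(2)] ad_sym[OF ads(3)]
    consider "a \<in> v" "z \<in> B" | "z \<in> v" "a \<in> B" | "a \<in> v" "b \<in> B" | "b \<in> v" "a \<in> B"
      | "b \<in> v" "z \<in> B" | "z \<in> v" "b \<in> B" | "\<not> (\<exists>p\<in>{a, b, z}. p \<in> v) \<or> \<not> (\<exists>p\<in>{a, b, z}. p \<in> B)"
      using disj by blast
    then show "c a z = (c a b \<noteq> c b z)"
    proof cases
      case 1
      then show ?thesis
        using tri_vB[of a z b] ads by blast
    next
      case 2
      then show ?thesis
        using tri_vB[of z a b] s c_sym by metis
    next
      case 3
      then show ?thesis
        using tri_vB[of a b z] ads s c_sym by metis
    next
      case 4
      then show ?thesis
        using tri_vB[of b a z] ads s c_sym by metis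
    next
      case 5
      then show ?thesis
        using tri_vB[of b z a] ads s c_sym by metis
    next
      case 6
      then show ?thesis
        using tri_vB[of z b a] ads s c_sym by metis
    next
      case 7
      then show ?thesis
        using c_out c_in by auto
    qed
  qed
  with S_sc[unfolded simply_connected_def, THEN spec, of c]
  have "\<exists>\<phi> :: 'a \<Rightarrow> bool. \<forall>a b. ad a b \<longrightarrow> c a b = (\<phi> a \<noteq> \<phi> b)"
    by (rule mp)
  then obtain \<phi> :: "'a \<Rightarrow> bool" where \<phi>: "\<And>a b. ad a b \<Longrightarrow> c a b = (\<phi> a \<noteq> \<phi> b)"
    by (elim exE) simp
  have \<phi>_v: "\<phi> a = \<phi> g" if "a \<in> v" for a
  proof -
    have "mono_adj\<^sup>*\<^sup>* g a"
      using that by (simp add: v_def component_def)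
    then have "\<phi> a = \<phi> g \<and> a \<in> v"
    proof (induction rule: rtranclp_induct)
      case base
      then show ?case
        by (simp add: v_def)
    next
      case (step a b)
      then have "b \<in> v" "ad a b"
        using component_step by (auto simp: v_def mono_adj_def)
      then show ?case
        using step \<phi>[of a b] c_in[of a b] disj by auto
    qed
    then show ?thesis
      by blast
  qed
  have \<phi>_B: "\<phi> a = \<phi> y" if "a \<in> B" for a
  proof -
    have "(outside v)\<^sup>*\<^sup>* y a"
      using that by (simp add: B_def branch_def)
    then show ?thesis
    proof (induction rule: rtranclp_induct)
      case (step a b)
      then show ?case
        using \<phi>[of a b] c_out[of a b] by (auto simp: outside_def)
    qed simp
  qed
  \<comment> \<open>Membership of \<open>e\<close> in \<open>D\<close> forces different values of
    \<open>\<phi>\<close> on the two sides, so \<open>c\<close> holds on every edge of the cut, in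
    particular on \<open>f\<close>.\<close>
  obtain a b where ab: "e = (a, b)" "a \<in> v" "b \<in> B" "ad a b"
    using e' by (auto simp: \<Omega>_def edge_cut_def)
  have "e \<in> D"
    by (simp add: D_def)
  then have "\<phi> g \<noteq> \<phi> y"
    using ab \<phi>[of a b] \<phi>_v \<phi>_B by (auto simp: c_def)
  obtain a' b' where ab': "f = (a', b')" "a' \<in> v" "b' \<in> B" "ad a' b'"
    using f' by (auto simp: \<Omega>_def edge_cut_def)
  then have "c a' b'"
    using \<phi>[of a' b'] \<phi>_v \<phi>_B \<open>\<phi> g \<noteq> \<phi> y\<close> by auto
  then have "f \<in> D"
    using ab' c_vB by simp
  then show ?thesis
    by (simp add: D_def \<Omega>_def v_def B_def)
qed

text \<open>
  At a component which is not central some branch has at most two translates, so that its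
  stabiliser, which acts freely on the edge_cut, has index at most two.
\<close>

lemma stab_generators:
  assumes g: "g \<in> carrier G" and nc: "\<not> central g"
  shows "cross g \<noteq> {} \<and> (\<exists>Gs \<subseteq> stab g. finite Gs \<and> card Gs \<le> 2 * card S * card (cross g) + 1 \<and>
    generate G Gs = stab g)"
proof -
  define v where "v = component g"
  obtain y where y: "y \<in> carrier G - v" and big: "\<mu> (branch v y) > 1 / 3"
    using nc by (auto simp: central_def v_def not_le)
  define B where "B = branch v y"
  define \<Omega> where "\<Omega> = edge_cut v B"
  have vc: "v \<subseteq> carrier G"
    using component_carrier[OF g] by (simp add: v_def)
  have Bsub: "B \<subseteq> carrier G - v"
    using branch_subset[OF y] by (simp add: B_def)
  define A where "A = stab g"
  have A: "subgroup A G"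
    using subgroup_stab[OF g] by (simp add: A_def)
  have AH: "a \<in> H" "a <# v = v" "a \<in> carrier G" if "a \<in> A" for a
    using that Hc by (auto simp: A_def stab_def v_def)
  have Av: "a \<otimes> x \<in> v" if "a \<in> A" "x \<in> v" for a x
    using AH(2)[OF that(1)] that(2) unfolding l_coset_def by blast
  define C where "C = {a \<in> A. a <# B = B}"
  have C: "subgroup C G"
    unfolding C_def using A Bsub by (intro subgroup_l_coset_stabilizer) auto
  have CA: "C \<subseteq> A"
    by (auto simp: C_def)
  have CB: "a \<otimes> x \<in> B" if "a \<in> C" "x \<in> B" for a x
    using that unfolding C_def l_coset_def by blast
  have transl: "a <# B = branch v (a \<otimes> y)" "a \<otimes> y \<in> carrier G - v" if a: "a \<in> A" for a
  proof -
    show eq: "a <# B = branch v (a \<otimes> y)"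
      using branch_l_coset[OF AH(3)[OF a] vc y] AH(2)[OF a] by (simp add: B_def)
    show "a \<otimes> y \<in> carrier G - v"
    proof -
      have "a \<otimes> y \<notin> v"
      proof
        assume "a \<otimes> y \<in> v"
        then have "inv a \<otimes> (a \<otimes> y) \<in> v"
          using Av[of "inv a" "a \<otimes> y"] A a by (simp add: subgroup.m_inv_closed)
        then show False
          using y AH(3)[OF a] by simp
      qed
      then show ?thesis
        using y AH(3)[OF a] by simp
    qed
  qed
  \<comment> \<open>Otherwise \<open>B\<close>, \<open>a <# B\<close> and \<open>b <# B\<close>
    would be three disjoint branches of equal mean above \<open>1 / 3\<close>.\<close>
  have two: "a <# B = b <# B" if ab: "a \<in> A - C" "b \<in> A - C" for a b
  proof (rule ccontr)
    assume ne: "a <# B \<noteq> b <# B"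
    have disj: "branch v x \<inter> branch v z = {}" if "branch v x \<noteq> branch v z" for x z
      using that branch_eq by blast
    have ne2: "B \<noteq> a <# B" "B \<noteq> b <# B"
      using ab by (auto simp: C_def)
    have d: "B \<inter> (a <# B) = {}" "B \<inter> (b <# B) = {}" "(a <# B) \<inter> (b <# B) = {}"
      using disj[of y "a \<otimes> y"] disj[of y "b \<otimes> y"] disj[of "a \<otimes> y" "b \<otimes> y"] ne ne2 ab transl
      by (auto simp: B_def)
    have "B \<subseteq> carrier G"
      using Bsub by blast
    then have Bc: "B \<subseteq> carrier G" "a <# B \<subseteq> carrier G" "b <# B \<subseteq> carrier G"
      using ab AH(3) by (simp_all add: l_coset_subset_G)
    have "\<mu> (B \<union> (a <# B) \<union> (b <# B)) = \<mu> (B \<union> (a <# B)) + \<mu> (b <# B)"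
      using Bc d by (intro mean_Un) auto
    also have "\<mu> (B \<union> (a <# B)) = \<mu> B + \<mu> (a <# B)"
      using Bc d by (intro mean_Un) auto
    finally have "\<mu> (B \<union> (a <# B) \<union> (b <# B)) = 3 * \<mu> B"
      using ab AH Bc mean_l_coset by simp
    moreover have "\<mu> (B \<union> (a <# B) \<union> (b <# B)) \<le> 1"
      using mean_mono[of "B \<union> (a <# B) \<union> (b <# B)" "carrier G"] Bc mean_carrier by auto
    ultimately show False
      using big by (simp add: B_def)
  qed
  \<comment> \<open>The coset of the start and the generator along the edge: unchanged by left
    translation with \<open>H\<close>, and an element of \<open>cross g\<close>.\<close>
  define \<kappa> where "\<kappa> e = (H #> fst e, inv (fst e) \<otimes> snd e)" for e
  have \<kappa>_sub: "\<kappa> ` \<Omega> \<subseteq> cross g"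
  proof (rule image_subsetI)
    fix e assume "e \<in> \<Omega>"
    then obtain x z where e: "e = (x, z)" "x \<in> v" "z \<in> B" "ad x z"
      by (auto simp: \<Omega>_def edge_cut_def)
    have xz: "x \<in> carrier G" "z \<in> carrier G" "z = x \<otimes> (inv x \<otimes> z)"
      using e ad_carrier by auto
    have "lab x \<noteq> lab z"
      using e component_step[of x g z] Bsub by (auto simp: v_def mono_adj_def)
    then have "x \<in> component g \<and> inv x \<otimes> z \<in> S \<and> lab x \<noteq> lab (x \<otimes> (inv x \<otimes> z))"
      using e xz by (auto simp: v_def adj_def)
    then show "\<kappa> e \<in> cross g"
      unfolding cross_def \<kappa>_def using e by auto
  qed
  have \<Omega>_ne: "\<Omega> \<noteq> {}"
    using branch_has_edge[OF g y[unfolded v_def]] by (auto simp: \<Omega>_def edge_cut_def v_def B_def)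
  define act where "act c e = (c \<otimes> fst e, c \<otimes> snd e)" for c and e :: "'a \<times> 'a"
  have \<Omega>c: "fst e \<in> carrier G" "snd e \<in> carrier G" if "e \<in> \<Omega>" for e
    using that ad_carrier by (auto simp: \<Omega>_def edge_cut_def)
  have "\<exists>Gs \<subseteq> C. finite Gs \<and> card Gs \<le> card (\<kappa> ` \<Omega>) * (2 * card S) \<and> generate G Gs = C"
  proof (rule generators_from_free_action[where act = act and E = cut_adj])
    show "subgroup C G"
      by (rule C)
    have Cc: "c \<in> carrier G" if "c \<in> C" for c
      using that CA AH by blast
    show "act c e \<in> \<Omega>" if "c \<in> C" "e \<in> \<Omega>" for c e
      using that Av CB CA adj_mult_left[OF Cc] by (auto simp: \<Omega>_def edge_cut_def act_def)
    show "act (c \<otimes> d) e = act c (act d e)" if "c \<in> C" "d \<in> C" "e \<in> \<Omega>" for c d e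
      using that \<Omega>c Cc by (simp add: act_def m_assoc)
    show "act \<one> e = e" if "e \<in> \<Omega>" for e
      using that \<Omega>c by (simp add: act_def)
    show "c = \<one>" if "c \<in> C" "e \<in> \<Omega>" "act c e = e" for c e
      using that \<Omega>c[of e] Cc[of c] by (auto simp: act_def prod_eq_iff)
    show "cut_adj (act c e) (act c f)" if "c \<in> C" "e \<in> \<Omega>" "f \<in> \<Omega>" "cut_adj e f" for c e f
      using that adj_mult_left[OF Cc] by (auto simp: cut_adj_def act_def)
    show "(\<lambda>a b. a \<in> \<Omega> \<and> b \<in> \<Omega> \<and> cut_adj a b)\<^sup>*\<^sup>* e f" if "e \<in> \<Omega>" "f \<in> \<Omega>" for e f
      using cut_connected[OF g y[unfolded v_def]] that by (simp add: \<Omega>_def v_def B_def)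
    show "finite (\<kappa> ` \<Omega>)"
      using \<kappa>_sub finite_cross[OF g] finite_subset by blast
    show "\<kappa> (act c e) = \<kappa> e" if "c \<in> C" "e \<in> \<Omega>" for c e
    proof -
      have "c \<in> H" "c \<in> carrier G"
        using that CA AH by auto
      then show ?thesis
        using \<Omega>c[OF that(2)] by (simp add: \<kappa>_def act_def r_coset_left inv_mult_group m_assoc)
    qed
    \<comment> \<open>Equal keys give some \<open>h\<close> in \<open>H\<close> that moves
      \<open>e\<close> to \<open>f\<close>. It fixes \<open>v\<close>, because both edges start
      there, and so permutes the branches at \<open>v\<close>; it fixes \<open>B\<close>, because
      both edges end there.\<close>
    show "\<exists>c\<in>C. f = act c e" if ef: "e \<in> \<Omega>" "f \<in> \<Omega>" "\<kappa> e = \<kappa> f" for e f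
    proof -
      obtain h where h: "h \<in> H" "fst f = h \<otimes> fst e"
        using r_coset_eqE[of "fst e" "fst f"] \<Omega>c ef by (auto simp: \<kappa>_def)
      have hc: "h \<in> carrier G"
        using h Hc by blast
      have "snd f = fst f \<otimes> (inv (fst f) \<otimes> snd f)"
        using \<Omega>c ef by simp
      also have "\<dots> = h \<otimes> fst e \<otimes> (inv (fst e) \<otimes> snd e)"
        using ef h by (simp add: \<kappa>_def)
      also have "\<dots> = h \<otimes> snd e"
        using \<Omega>c[OF ef(1)] hc by (simp add: m_assoc)
      finally have s: "snd f = h \<otimes> snd e" .
      have ev: "fst e \<in> v" "snd e \<in> B" "fst f \<in> v" "snd f \<in> B"
        using ef by (auto simp: \<Omega>_def edge_cut_def)
      have "component (h \<otimes> fst e) = v" "component (fst e) = v"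
        using ev h component_eq by (auto simp: v_def)
      then have hA: "h \<in> A"
        using component_l_coset[OF h(1) \<Omega>c(1)[OF ef(1)]] h(1) by (simp add: A_def stab_def v_def)
      have "snd f \<in> h <# B"
        unfolding s l_coset_def using ev by blast
      then have "h <# B = B"
        using transl(1)[OF hA] ev(4) branch_eq unfolding B_def by metis
      then show ?thesis
        using hA h s by (auto simp: C_def act_def prod_eq_iff)
    qed
    show "finite {f \<in> \<Omega>. cut_adj e f} \<and> card {f \<in> \<Omega>. cut_adj e f} \<le> 2 * card S" if "e \<in> \<Omega>" for e
    proof -
      \<comment> \<open>A related edge keeps one end and moves the other by an element of
        \<open>S\<close>, which gives the degree bound \<open>2 * card S\<close>.\<close>
      let ?N = "(\<lambda>s. (fst e, snd e \<otimes> s)) ` S \<union> (\<lambda>s. (fst e \<otimes> s, snd e)) ` S"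
      have sub: "{f \<in> \<Omega>. cut_adj e f} \<subseteq> ?N"
      proof
        fix f assume "f \<in> {f \<in> \<Omega>. cut_adj e f}"
        then have f: "f \<in> \<Omega>" "cut_adj e f"
          by auto
        note c = \<Omega>c[OF that] \<Omega>c[OF f(1)]
        from f(2) show "f \<in> ?N"
          unfolding cut_adj_def
        proof
          assume *: "fst e = fst f \<and> ad (snd e) (snd f)"
          then have "f = (fst e, snd e \<otimes> (inv (snd e) \<otimes> snd f))"
            using c by (simp add: prod_eq_iff)
          moreover have "inv (snd e) \<otimes> snd f \<in> S"
            using * by (simp add: adj_def)
          ultimately show ?thesis
            by blast
        next
          assume *: "snd e = snd f \<and> ad (fst e) (fst f)"
          then have "f = (fst e \<otimes> (inv (fst e) \<otimes> fst f), snd e)"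
            using c by (simp add: prod_eq_iff)
          moreover have "inv (fst e) \<otimes> fst f \<in> S"
            using * by (simp add: adj_def)
          ultimately show ?thesis
            by blast
        qed
      qed
      have "card ?N \<le> card S + card S"
        using S by (meson add_mono card_Un_le card_image_le le_trans)
      moreover have fin: "finite ?N"
        using S by simp
      ultimately have "card {f \<in> \<Omega>. cut_adj e f} \<le> 2 * card S"
        using card_mono[OF fin sub] by linarith
      then show ?thesis
        using finite_subset[OF sub fin] by blast
    qed
  qed (rule \<Omega>_ne)
  then obtain Gs where Gs: "Gs \<subseteq> C" "finite Gs" "card Gs \<le> card (\<kappa> ` \<Omega>) * (2 * card S)"
    "generate G Gs = C"
    by blast
  have "card (\<kappa> ` \<Omega>) \<le> card (cross g)"
    using \<kappa>_sub finite_cross[OF g] by (intro card_mono)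
  then have "card (\<kappa> ` \<Omega>) * (2 * card S) \<le> card (cross g) * (2 * card S)"
    by (rule mult_le_mono1)
  with Gs(3) have "card Gs \<le> card (cross g) * (2 * card S)"
    by (rule le_trans)
  then have card_Gs: "card Gs \<le> 2 * card S * card (cross g)"
    by (simp only: mult_ac)
  have "\<exists>Gs \<subseteq> A. finite Gs \<and> card Gs \<le> 2 * card S * card (cross g) + 1 \<and> generate G Gs = A"
  proof (cases "A = C")
    case True
    then show ?thesis
      using Gs card_Gs by (intro exI[of _ Gs]) auto
  next
    case False
    then obtain a where a: "a \<in> A - C"
      using CA by blast
    let ?Gs = "insert a Gs"
    have sub: "?Gs \<subseteq> A"
      using a Gs CA by auto
    then have subc: "?Gs \<subseteq> carrier G"
      using AH by blast
    \<comment> \<open>By \<open>two\<close> all elements of \<open>A - C\<close> translate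
      \<open>B\<close> in the same way, so they lie in the coset of \<open>a\<close> modulo
      \<open>C\<close>.\<close>
    have "A \<subseteq> generate G ?Gs"
    proof
      fix b assume b: "b \<in> A"
      have CG: "C \<subseteq> generate G ?Gs"
        using Gs(4) mono_generate[of Gs ?Gs] by auto
      show "b \<in> generate G ?Gs"
      proof (cases "b \<in> C")
        case False
        have bc: "a \<in> carrier G" "b \<in> carrier G" "B \<subseteq> carrier G"
          using a b AH Bsub by auto
        have "inv a \<otimes> b \<in> A"
          using a b A by (simp add: subgroup.m_closed subgroup.m_inv_closed)
        moreover have "(inv a \<otimes> b) <# B = inv a <# (b <# B)"
          using bc by (simp add: lcos_m_assoc)
        moreover have "\<dots> = inv a <# (a <# B)"
          using two[of a b] a b False by simp
        moreover have "\<dots> = B"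
          using bc by (simp add: lcos_m_assoc lcos_mult_one)
        ultimately have "inv a \<otimes> b \<in> C"
          by (simp add: C_def)
        then have "a \<otimes> (inv a \<otimes> b) \<in> generate G ?Gs"
          using CG generate.eng[OF generate.incl[of a ?Gs G], of "inv a \<otimes> b"] by blast
        then show ?thesis
          using bc by simp
      qed (use CG in auto)
    qed
    moreover have "generate G ?Gs \<subseteq> A"
      using sub A by (rule generate_subgroup_incl)
    moreover have "card ?Gs \<le> 2 * card S * card (cross g) + 1"
      using card_Gs card_insert_le_m1[of _ Gs a] Gs(2) by (simp add: card_insert_if)
    ultimately show ?thesis
      using sub Gs(2) by (intro exI[of _ ?Gs]) auto
  qed
  \<comment> \<open>Recorded so that the summand 1 in the rank bound can later be absorbed into a
    multiple of \<open>card (cross g)\<close>.\<close>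
  moreover have "cross g \<noteq> {}"
    using \<kappa>_sub \<Omega>_ne by auto
  ultimately show ?thesis
    by (simp add: A_def)
qed

text \<open>\<open>H\<close> fixes a central component and acts on it freely; as a graph it is
  connected of degree at most \<open>card S\<close>. Its orbits are cosets carrying a single label,
  so there are at most \<open>K\<close> of them.\<close>

lemma central_generators:
  assumes g: "g \<in> carrier G" and cen: "central g"
    and K: "\<And>l. card {Y \<in> rcosets H. \<exists>x \<in> Y. lab x = l} \<le> K"
  shows "\<exists>Gs \<subseteq> H. finite Gs \<and> card Gs \<le> K * card S \<and> generate G Gs = H"
proof -
  define \<Omega> where "\<Omega> = component g"
  have \<Omega>c: "x \<in> carrier G" if "x \<in> \<Omega>" for x
    using that component_carrier[OF g] by (auto simp: \<Omega>_def)
  have "\<exists>Gs \<subseteq> H. finite Gs \<and> card Gs \<le> card ((\<lambda>x. H #> x) ` \<Omega>) * card S \<and> generate G Gs = H"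
  proof (rule generators_from_free_action[where act = "(\<otimes>)" and E = mono_adj])
    show "subgroup H G"
      by (rule H)
    show "h \<otimes> x \<in> \<Omega>" if "h \<in> H" "x \<in> \<Omega>" for h x
    proof -
      have "h <# \<Omega> = \<Omega>"
        using central_fixed[OF g cen that(1)] by (simp add: stab_def \<Omega>_def)
      then show ?thesis
        using that unfolding l_coset_def by blast
    qed
    show "(c \<otimes> d) \<otimes> x = c \<otimes> (d \<otimes> x)" if "c \<in> H" "d \<in> H" "x \<in> \<Omega>" for c d x
      using that Hc \<Omega>c by (simp add: m_assoc)
    show "\<one> \<otimes> x = x" if "x \<in> \<Omega>" for x
      using that \<Omega>c by simp
    show "c = \<one>" if "c \<in> H" "x \<in> \<Omega>" "c \<otimes> x = x" for c x
      using that Hc \<Omega>c[of x] by auto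
    show "mono_adj (c \<otimes> x) (c \<otimes> x')" if "c \<in> H" "x \<in> \<Omega>" "x' \<in> \<Omega>" "mono_adj x x'" for c x x'
      using that mono_left by blast
    show "(\<lambda>a b. a \<in> \<Omega> \<and> b \<in> \<Omega> \<and> mono_adj a b)\<^sup>*\<^sup>* x x'" if "x \<in> \<Omega>" "x' \<in> \<Omega>" for x x'
    proof -
      have "mono_adj\<^sup>*\<^sup>* x x'"
        using that component_eq unfolding \<Omega>_def component_def by blast
      then have "(\<lambda>a b. a \<in> \<Omega> \<and> b \<in> \<Omega> \<and> mono_adj a b)\<^sup>*\<^sup>* x x' \<and> x' \<in> \<Omega>"
      proof (induction rule: rtranclp_induct)
        case (step y z)
        then have "z \<in> \<Omega>"
          using component_step by (auto simp: \<Omega>_def)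
        then show ?case
          using step by (auto intro: rtranclp.rtrancl_into_rtrancl)
      qed (use that in simp)
      then show ?thesis
        by blast
    qed
    show "finite ((\<lambda>x. H #> x) ` \<Omega>)"
      using rcosetsI[OF subgroup.subset[OF H(1)] \<Omega>c] finite_subset[OF _ H(2)]
      by (simp add: image_subsetI)
    show "\<exists>c\<in>H. x' = c \<otimes> x" if "x \<in> \<Omega>" "x' \<in> \<Omega>" "H #> x = H #> x'" for x x'
      using r_coset_eqE[of x x'] that \<Omega>c by blast
    show "H #> (c \<otimes> x) = H #> x" if "c \<in> H" "x \<in> \<Omega>" for c x
      using that \<Omega>c r_coset_left by blast
    show "finite {x' \<in> \<Omega>. mono_adj x x'} \<and> card {x' \<in> \<Omega>. mono_adj x x'} \<le> card S" if "x \<in> \<Omega>" for x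
    proof -
      have "{x' \<in> \<Omega>. mono_adj x x'} \<subseteq> (\<lambda>s. x \<otimes> s) ` S"
      proof
        fix x' assume "x' \<in> {x' \<in> \<Omega>. mono_adj x x'}"
        then have "inv x \<otimes> x' \<in> S" "x' \<in> carrier G"
          using \<Omega>c by (auto simp: mono_adj_def adj_def)
        moreover have "x' = x \<otimes> (inv x \<otimes> x')"
          using \<Omega>c[OF that] calculation by simp
        ultimately show "x' \<in> (\<lambda>s. x \<otimes> s) ` S"
          by blast
      qed
      then show ?thesis
        using S(1) by (meson card_image_le card_mono finite_imageI finite_subset le_trans)
    qed
    show "\<Omega> \<noteq> {}"
      unfolding \<Omega>_def using component_self by blast
  qed
  moreover have "(\<lambda>x. H #> x) ` \<Omega> \<subseteq> {Y \<in> rcosets H. \<exists>x \<in> Y. lab x = lab g}"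
  proof (rule image_subsetI)
    fix x assume x: "x \<in> \<Omega>"
    then have "lab x = lab g"
      using component_lab by (simp add: \<Omega>_def)
    moreover have "x \<in> H #> x"
      using rcos_self[OF \<Omega>c[OF x] H(1)] .
    ultimately show "H #> x \<in> {Y \<in> rcosets H. \<exists>x \<in> Y. lab x = lab g}"
      using \<Omega>c[OF x] by (auto simp: RCOSETS_def)
  qed
  then have "card ((\<lambda>x. H #> x) ` \<Omega>) \<le> card {Y \<in> rcosets H. \<exists>x \<in> Y. lab x = lab g}"
    using H(2) by (intro card_mono) auto
  then have "card ((\<lambda>x. H #> x) ` \<Omega>) * card S \<le> K * card S"
    using K le_trans by (intro mult_le_mono1) blast
  ultimately show ?thesis
    using le_trans by blast
qed

end

section \<open>The rank of a finite index subgroup\<close>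

text \<open>Without a central component, \<open>H\<close> is generated by the stabilisers of one
  component per orbit and one element per cross edge. As the sets \<open>cross r\<close> are
  disjoint, the stabilisers cost \<open>2 * card S + 1\<close> generators for each cross edge; the
  element attached to the edge makes it \<open>2 * card S + 2\<close>.\<close>

lemma (in colored_cayley) rank_bound:
  assumes K: "\<And>l. card {Y \<in> rcosets H. \<exists>x \<in> Y. lab x = l} \<le> K"
  shows "\<exists>Gs \<subseteq> H. finite Gs \<and> generate G Gs = H \<and>
    card Gs \<le> K * card S + (2 * card S + 2) * card cross_edges"
proof (cases "\<exists>g \<in> carrier G. central g")
  case True
  then obtain Gs where "Gs \<subseteq> H" "finite Gs" "card Gs \<le> K * card S" "generate G Gs = H"
    using central_generators K by blast
  then show ?thesis
    by (intro exI[of _ Gs]) auto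
next
  case False
  define orb where "orb x = {y. \<exists>h \<in> H. y \<in> component (h \<otimes> x)}" for x
  have H1: "\<one> \<in> H"
    using H by (simp add: subgroup.one_closed)
  have orb_self: "x \<in> orb x" if "x \<in> carrier G" for x
    unfolding orb_def using that H1 by (auto intro!: bexI[of _ \<one>])
  have orb_carrier: "y \<in> carrier G" if "x \<in> carrier G" "y \<in> orb x" for x y
    using that Hc component_carrier[of "_ \<otimes> x"] by (auto simp: orb_def)
  have orb_sub: "orb y \<subseteq> orb x" if xy: "x \<in> carrier G" "y \<in> orb x" for x y
  proof
    fix z assume "z \<in> orb y"
    then obtain h k where h: "h \<in> H" "y \<in> component (h \<otimes> x)" and k: "k \<in> H" "z \<in> component (k \<otimes> y)"
      using xy by (auto simp: orb_def)
    have "k \<otimes> y \<in> component (k \<otimes> (h \<otimes> x))"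
      using component_left[OF k(1) h(2)] .
    then have "z \<in> component ((k \<otimes> h) \<otimes> x)"
      using component_eq k h xy Hc by (simp add: m_assoc)
    then show "z \<in> orb x"
      unfolding orb_def using H h k by (auto simp: subgroup.m_closed)
  qed
  have orb_sym: "x \<in> orb y" if xy: "x \<in> carrier G" "y \<in> orb x" for x y
  proof -
    obtain h where h: "h \<in> H" "y \<in> component (h \<otimes> x)"
      using xy by (auto simp: orb_def)
    have hi: "inv h \<in> H"
      using H h by (simp add: subgroup.m_inv_closed)
    have "inv h \<otimes> y \<in> component (inv h \<otimes> (h \<otimes> x))"
      using component_left[OF hi h(2)] .
    then have "x \<in> component (inv h \<otimes> y)"
      using component_sym h xy Hc by simp
    then show ?thesis
      unfolding orb_def using hi by blast
  qed
  have orb_eq: "orb y = orb x" if "x \<in> carrier G" "y \<in> orb x" for x y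
    using orb_sub[OF that] orb_sub[OF orb_carrier[OF that] orb_sym[OF that]] by blast
  \<comment> \<open>The choice depends on \<open>x\<close> only through the set
    \<open>orb x\<close>, so \<open>\<rho>\<close> is constant on each orbit of components.\<close>
  define \<rho> where "\<rho> x = (SOME r. r \<in> orb x)" for x
  have \<rho>: "\<rho> x \<in> orb x" "\<rho> x \<in> carrier G" "orb (\<rho> x) = orb x" "\<rho> (\<rho> x) = \<rho> x"
    if x: "x \<in> carrier G" for x
  proof -
    show 1: "\<rho> x \<in> orb x"
      unfolding \<rho>_def by (rule someI[of _ x]) (rule orb_self[OF x])
    show "\<rho> x \<in> carrier G"
      using orb_carrier[OF x 1] .
    show 2: "orb (\<rho> x) = orb x"
      using orb_eq[OF x 1] .
    show "\<rho> (\<rho> x) = \<rho> x"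
      unfolding \<rho>_def[of "\<rho> x"] 2 by (simp add: \<rho>_def)
  qed
  have \<rho>_eq: "\<rho> y = \<rho> x" if "x \<in> carrier G" "y \<in> orb x" for x y
    using orb_eq[OF that] by (simp add: \<rho>_def)
  have orb_left: "h \<otimes> x \<in> orb x" if "h \<in> H" "x \<in> carrier G" for h x
    unfolding orb_def using that component_self by blast
  \<comment> \<open>Moves the component of the representative onto that of \<open>x\<close>;
    determined only up to right multiplication by \<open>stab (\<rho> x)\<close>.\<close>
  define \<pi> where "\<pi> x = (SOME h. h \<in> H \<and> x \<in> component (h \<otimes> \<rho> x))" for x
  have \<pi>: "\<pi> x \<in> H" "x \<in> component (\<pi> x \<otimes> \<rho> x)" if x: "x \<in> carrier G" for x
  proof -
    have "x \<in> orb (\<rho> x)"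
      using \<rho>(3)[OF x] orb_self[OF x] by simp
    then have "\<exists>h. h \<in> H \<and> x \<in> component (h \<otimes> \<rho> x)"
      by (auto simp: orb_def)
    then have "\<pi> x \<in> H \<and> x \<in> component (\<pi> x \<otimes> \<rho> x)"
      unfolding \<pi>_def by (rule someI_ex)
    then show "\<pi> x \<in> H" "x \<in> component (\<pi> x \<otimes> \<rho> x)"
      by auto
  qed
  define Rep where "Rep = \<rho> ` carrier G"
  have Rep: "r \<in> carrier G" "\<rho> r = r" if "r \<in> Rep" for r
    using that \<rho> by (auto simp: Rep_def)
  have Rep_inj: "r = r'" if "r \<in> Rep" "r' \<in> Rep" "r' \<in> orb r" for r r'
    using \<rho>_eq[of r r'] Rep that by metis
  have "\<forall>r \<in> Rep. \<exists>Gs. Gs \<subseteq> stab r \<and> finite Gs \<and> card Gs \<le> 2 * card S * card (cross r) + 1 \<and> generate G Gs = stab r"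
    using stab_generators False Rep(1) by metis
  then obtain gens where gens: "\<And>r. r \<in> Rep \<Longrightarrow> gens r \<subseteq> stab r" "\<And>r. r \<in> Rep \<Longrightarrow> finite (gens r)"
    "\<And>r. r \<in> Rep \<Longrightarrow> card (gens r) \<le> 2 * card S * card (cross r) + 1"
    "\<And>r. r \<in> Rep \<Longrightarrow> generate G (gens r) = stab r"
    unfolding bchoice_iff by metis
  have cross_ne: "cross r \<noteq> {}" if "r \<in> Rep" for r
    using stab_generators False Rep(1)[OF that] by blast
  have finRep: "finite Rep"
  proof (rule finite_imageD)
    show "finite ((\<lambda>r. H #> r) ` Rep)"
      using rcosetsI[OF subgroup.subset[OF H(1)] Rep(1)] finite_subset[OF _ H(2)]
      by (simp add: image_subsetI)
    show "inj_on (\<lambda>r. H #> r) Rep"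
    proof (rule inj_onI)
      fix r r' assume rr: "r \<in> Rep" "r' \<in> Rep" "H #> r = H #> r'"
      then obtain h where "h \<in> H" "r' = h \<otimes> r"
        using r_coset_eqE[of r r'] Rep by blast
      then show "r = r'"
        using Rep_inj rr orb_left Rep by blast
    qed
  qed
  \<comment> \<open>A pair \<open>(H #> x, s)\<close> determines \<open>x\<close> up to
    \<open>H\<close>, hence the orbit of its component.\<close>
  have cross_disj: "cross r \<inter> cross r' = {}" if rr: "r \<in> Rep" "r' \<in> Rep" "r \<noteq> r'" for r r'
  proof (rule ccontr)
    assume "cross r \<inter> cross r' \<noteq> {}"
    then obtain x x' where x: "x \<in> component r" "x' \<in> component r'" "H #> x = H #> x'"
      by (auto simp: cross_def)
    have xc: "x \<in> carrier G" "x' \<in> carrier G"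
      using x component_carrier Rep rr by auto
    obtain h where h: "h \<in> H" "x' = h \<otimes> x"
      using r_coset_eqE[OF xc x(3)] .
    then have "x' \<in> component (h \<otimes> r)"
      using component_left x by simp
    then have "r' \<in> component (h \<otimes> r)"
      using component_eq component_sym x by metis
    then have "r' \<in> orb r"
      using h by (auto simp: orb_def)
    then show False
      using Rep_inj rr by blast
  qed
  define pick where "pick Y = (SOME y. y \<in> carrier G \<and> H #> y = Y)" for Y
  have pick: "pick (H #> y) \<in> carrier G" "H #> pick (H #> y) = H #> y" if "y \<in> carrier G" for y
  proof -
    have "pick (H #> y) \<in> carrier G \<and> H #> pick (H #> y) = H #> y"
      unfolding pick_def by (rule someI[of _ y]) (use that in simp)
    then show "pick (H #> y) \<in> carrier G" "H #> pick (H #> y) = H #> y"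
      by auto
  qed
  \<comment> \<open>One element for each cross edge of the Schreier graph, computed at the chosen
    lift \<open>pick Y\<close> of its start.\<close>
  define \<gamma> where "\<gamma> = (\<lambda>(Y, s). inv (\<pi> (pick Y)) \<otimes> \<pi> (pick Y \<otimes> s))"
  define Gs where "Gs = (\<Union>r\<in>Rep. gens r) \<union> \<gamma> ` cross_edges"
  have \<gamma>H: "\<gamma> e \<in> H" if "e \<in> cross_edges" for e
    using that \<pi>(1) pick S H by (auto simp: cross_edges_def \<gamma>_def subgroup.m_closed subgroup.m_inv_closed subset_iff)
  have GsH: "Gs \<subseteq> H"
    using gens(1) \<gamma>H by (auto simp: Gs_def stab_def)
  moreover have "finite Gs"
    using finRep gens finite_cross_edges by (auto simp: Gs_def)
  moreover have "card Gs \<le> (2 * card S + 2) * card cross_edges"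
  proof -
    have "card (\<Union>r\<in>Rep. gens r) \<le> (\<Sum>r\<in>Rep. card (gens r))"
      using finRep by (rule card_UN_le)
    also have "\<dots> \<le> (\<Sum>r\<in>Rep. (2 * card S + 1) * card (cross r))"
    proof (rule sum_mono)
      fix r assume r: "r \<in> Rep"
      have "card (cross r) > 0"
        using cross_ne[OF r] finite_cross Rep(1)[OF r] by (simp add: card_gt_0_iff)
      then show "card (gens r) \<le> (2 * card S + 1) * card (cross r)"
        using gens(3)[OF r] by simp
    qed
    also have "\<dots> = (2 * card S + 1) * card (\<Union>r\<in>Rep. cross r)"
      using finRep finite_cross Rep cross_disj by (subst card_UN_disjoint) (auto simp: sum_distrib_left)
    also have "\<dots> \<le> (2 * card S + 1) * card cross_edges"
      using cross_subset Rep finite_cross_edges by (intro mult_le_mono2 card_mono) auto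
    finally have "card (\<Union>r\<in>Rep. gens r) \<le> (2 * card S + 1) * card cross_edges" .
    moreover have "card (\<gamma> ` cross_edges) \<le> card cross_edges"
      using finite_cross_edges by (rule card_image_le)
    ultimately show ?thesis
      using card_Un_le[of "\<Union>r\<in>Rep. gens r" "\<gamma> ` cross_edges"] by (simp add: Gs_def)
  qed
  moreover have "generate G Gs = H"
  proof
    show "generate G Gs \<subseteq> H"
      using GsH H(1) by (rule generate_subgroup_incl)
    define M where "M = generate G Gs"
    have M: "subgroup M G"
      unfolding M_def using GsH Hc by (intro generate_is_subgroup) auto
    have stabM: "stab r \<subseteq> M" if "r \<in> Rep" for r
    proof -
      have "gens r \<subseteq> Gs"
        using that by (auto simp: Gs_def)
      then show ?thesis
        unfolding M_def gens(4)[OF that, symmetric] by (rule mono_generate)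
    qed
    have \<gamma>M: "\<gamma> e \<in> M" if "e \<in> cross_edges" for e
      unfolding M_def using that by (intro generate.incl) (auto simp: Gs_def)
    \<comment> \<open>Both elements carry the component of \<open>r\<close> onto that of
      \<open>x\<close>, so they differ by the stabiliser of the former.\<close>
    have same: "inv a \<otimes> b \<in> M"
      if "a \<in> H" "b \<in> H" "r \<in> Rep" "x \<in> component (a \<otimes> r)" "x \<in> component (b \<otimes> r)" for a b r x
    proof -
      have c: "a \<in> carrier G" "b \<in> carrier G" "r \<in> carrier G"
        using that Hc Rep by auto
      have ab: "inv a \<otimes> b \<in> H" "inv a \<in> H"
        using that H by (simp_all add: subgroup.m_closed subgroup.m_inv_closed)
      have "b \<otimes> r \<in> component (a \<otimes> r)"
        using that component_eq component_sym by metis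
      then have "inv a \<otimes> (b \<otimes> r) \<in> component (inv a \<otimes> (a \<otimes> r))"
        by (rule component_left[OF ab(2)])
      then have "inv a \<otimes> b \<in> stab r"
        using c ab by (simp add: stab_iff m_assoc)
      then show ?thesis
        using stabM that by blast
    qed
    have \<pi>c: "\<pi> x \<in> carrier G" if "x \<in> carrier G" for x
      using \<pi>(1)[OF that] Hc by blast
    have \<rho>R: "\<rho> x \<in> Rep" if "x \<in> carrier G" for x
      using that by (simp add: Rep_def)
    \<comment> \<open>Equivariance of \<open>\<pi>\<close>, which here is only available modulo
      \<open>M\<close> because \<open>\<pi>\<close> involves a choice.\<close>
    have left: "inv (\<pi> (h \<otimes> x)) \<otimes> (h \<otimes> \<pi> x) \<in> M" if hx: "h \<in> H" "x \<in> carrier G" for h x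
    proof (rule same[OF _ _ \<rho>R[OF hx(2)], of _ _ "h \<otimes> x"])
      have hxc: "h \<otimes> x \<in> carrier G" "h \<in> carrier G"
        using hx Hc by auto
      show "\<pi> (h \<otimes> x) \<in> H" "h \<otimes> \<pi> x \<in> H"
        using hx hxc \<pi>(1) H by (simp_all add: subgroup.m_closed)
      show "h \<otimes> x \<in> component (\<pi> (h \<otimes> x) \<otimes> \<rho> x)"
        using \<pi>(2)[OF hxc(1)] \<rho>_eq[OF hx(2) orb_left[OF hx]] by simp
      have "h \<otimes> x \<in> component (h \<otimes> (\<pi> x \<otimes> \<rho> x))"
        using component_left[OF hx(1) \<pi>(2)[OF hx(2)]] .
      then show "h \<otimes> x \<in> component (h \<otimes> \<pi> x \<otimes> \<rho> x)"
        using hxc \<pi>c hx \<rho> by (simp add: m_assoc)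
    qed
    have step: "inv (\<pi> x) \<otimes> \<pi> z \<in> M" if xz: "ad x z" for x z
    proof -
      have c: "x \<in> carrier G" "z \<in> carrier G"
        using xz ad_carrier by auto
      show ?thesis
      proof (cases "lab x = lab z")
        case True
        have "z \<in> component x"
          using True xz component_step[OF component_self, of x z] by (simp add: mono_adj_def)
        have "z \<in> orb x"
          unfolding orb_def using \<open>z \<in> component x\<close> c H1 by (auto intro!: bexI[of _ \<one>])
        then have "\<rho> z = \<rho> x"
          using \<rho>_eq c by blast
        moreover have "x \<in> component (\<pi> z \<otimes> \<rho> z)"
          using \<pi>(2)[OF c(2)] component_eq component_sym[OF \<open>z \<in> component x\<close>] by metis
        ultimately show ?thesis
          using same[OF \<pi>(1)[OF c(1)] \<pi>(1)[OF c(2)] \<rho>R[OF c(1)] \<pi>(2)[OF c(1)]] by simp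
      next
        case False
        define s where "s = inv x \<otimes> z"
        define y where "y = pick (H #> x)"
        have s: "s \<in> S" "s \<in> carrier G" "z = x \<otimes> s"
          using xz c S by (auto simp: s_def adj_def)
        have y: "y \<in> carrier G" "H #> y = H #> x"
          using pick[OF c(1)] by (auto simp: y_def)
        \<comment> \<open>\<open>x\<close> need not be the chosen lift of its coset. The edge is the
          translate by \<open>h\<close> of the one starting at \<open>y\<close>, and by
          \<open>left\<close> the errors of equivariance at both ends lie in
          \<open>M\<close>.\<close>
        obtain h where h: "h \<in> H" "x = h \<otimes> y"
          using r_coset_eqE[OF y(1) c(1) y(2)] .
        have hc: "h \<in> carrier G"
          using h Hc by blast
        have zh: "z = h \<otimes> (y \<otimes> s)"
          using s h y hc by (simp add: m_assoc)
        have "(H #> x, s) \<in> cross_edges"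
          using False s c by (auto simp: cross_edges_def)
        then have "\<gamma> (H #> x, s) \<in> M"
          by (rule \<gamma>M)
        then have g: "inv (\<pi> y) \<otimes> \<pi> (y \<otimes> s) \<in> M"
          by (simp add: \<gamma>_def y_def)
        have l: "inv (\<pi> x) \<otimes> (h \<otimes> \<pi> y) \<in> M"
          using left[OF h(1) y(1)] h(2) by simp
        have ysc: "y \<otimes> s \<in> carrier G"
          using y s by simp
        have "inv (\<pi> z) \<otimes> (h \<otimes> \<pi> (y \<otimes> s)) \<in> M"
          using left[OF h(1) ysc] zh by simp
        then have "inv (inv (\<pi> z) \<otimes> (h \<otimes> \<pi> (y \<otimes> s))) \<in> M"
          using M by (simp add: subgroup.m_inv_closed)
        moreover have "inv (inv (\<pi> z) \<otimes> (h \<otimes> \<pi> (y \<otimes> s))) = inv (\<pi> (y \<otimes> s)) \<otimes> inv h \<otimes> \<pi> z"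
          using \<pi>c[OF c(2)] \<pi>c[OF ysc] hc by (simp add: inv_mult_group m_assoc)
        ultimately have r: "inv (\<pi> (y \<otimes> s)) \<otimes> inv h \<otimes> \<pi> z \<in> M"
          by simp
        have "(inv (\<pi> x) \<otimes> (h \<otimes> \<pi> y)) \<otimes> (inv (\<pi> y) \<otimes> \<pi> (y \<otimes> s)) \<otimes> (inv (\<pi> (y \<otimes> s)) \<otimes> inv h \<otimes> \<pi> z) \<in> M"
          using g l r M by (simp add: subgroup.m_closed)
        moreover have "(inv (\<pi> x) \<otimes> (h \<otimes> \<pi> y)) \<otimes> (inv (\<pi> y) \<otimes> \<pi> (y \<otimes> s)) \<otimes> (inv (\<pi> (y \<otimes> s)) \<otimes> inv h \<otimes> \<pi> z)
            = inv (\<pi> x) \<otimes> \<pi> z"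
          using \<pi>c[OF c(1)] \<pi>c[OF c(2)] \<pi>c[OF ysc] \<pi>c[OF y(1)] hc by (simp add: m_assoc)
        ultimately show ?thesis
          by simp
      qed
    qed
    show "H \<subseteq> generate G Gs"
    proof
      fix h assume h: "h \<in> H"
      \<comment> \<open>A walk from \<open>r\<close> to \<open>h \<otimes> r\<close> compares
        \<open>\<pi> r\<close> with \<open>\<pi> (h \<otimes> r)\<close>. The remaining factors,
        \<open>\<pi> r\<close> itself and the difference between
        \<open>\<pi> (h \<otimes> r)\<close> and \<open>h\<close>, are covered by the stabiliser of
        \<open>r\<close>.\<close>
      define r where "r = \<rho> \<one>"
      have r: "r \<in> Rep" "r \<in> carrier G" "\<rho> r = r"
        using \<rho>R[of \<one>] Rep by (auto simp: r_def)
      have hc: "h \<in> carrier G" "h \<otimes> r \<in> carrier G"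
        using h Hc r by auto
      have "\<rho> (h \<otimes> r) = r"
        using \<rho>_eq[OF r(2) orb_left[OF h r(2)]] r(3) by simp
      then have 1: "inv (\<pi> (h \<otimes> r)) \<otimes> h \<in> M"
        using same[OF \<pi>(1)[OF hc(2)] h r(1), of "h \<otimes> r"] \<pi>(2)[OF hc(2)] component_self by simp
      have "inv \<one> \<otimes> \<pi> r \<in> M"
        using same[OF H1 \<pi>(1)[OF r(2)] r(1), of r] \<pi>(2)[OF r(2)] r component_self by simp
      then have 2: "\<pi> r \<in> M"
        using \<pi>c r by simp
      have 3: "inv (\<pi> r) \<otimes> \<pi> (h \<otimes> r) \<in> M"
        using path_in_subgroup[OF M ad_connected[OF r(2) hc(2)], of \<pi>] step \<pi>c r ad_carrier by blast
      have "\<pi> r \<otimes> (inv (\<pi> r) \<otimes> \<pi> (h \<otimes> r)) \<otimes> (inv (\<pi> (h \<otimes> r)) \<otimes> h) \<in> M"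
        using 1 2 3 M by (simp add: subgroup.m_closed)
      moreover have "\<pi> r \<otimes> (inv (\<pi> r) \<otimes> \<pi> (h \<otimes> r)) \<otimes> (inv (\<pi> (h \<otimes> r)) \<otimes> h) = h"
        using \<pi>c[OF r(2)] \<pi>c[OF hc(2)] hc by (simp add: m_assoc)
      ultimately show "h \<in> generate G Gs"
        by (simp add: M_def)
    qed
  qed
  ultimately show ?thesis
    by (intro exI[of _ Gs]) auto
qed

text \<open>For each \<epsilon> > 0 the rank is at most a constant plus \<epsilon> times the index,
  with one constant for the whole sequence; and the index tends to infinity, since only finitely
  many subgroups have bounded index and the sequence is injective.\<close>

theorem theorem6:
  fixes G :: "('a, 'b) monoid_scheme" and H :: "nat \<Rightarrow> 'a set"
  assumes "group G" and "finitely_presented G" and "amenable G"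
    and "\<And>n. subgroup (H n) G"
    and "\<And>n. finite (rcosets\<^bsub>G\<^esub> H n)"
    and "inj H"
  shows "convergent (rank_gradient_seq G H) \<and> rank_gradient G H = 0"
proof -
  interpret group G
    by (rule assms(1))
  obtain S where S: "finite S" "S \<subseteq> carrier G" "\<one>\<^bsub>G\<^esub> \<in> S" "\<And>s. s \<in> S \<Longrightarrow> inv\<^bsub>G\<^esub> s \<in> S"
    "generate G S = carrier G" "simply_connected S"
    by (rule simply_connected_presentation[OF assms(2)]) (rule that)
  obtain \<mu> where "mean G \<mu>"
    using amenable_mean[OF assms(3)] .
  then interpret mean G \<mu> .
  define m where "m n = card (rcosets\<^bsub>G\<^esub> H n)" for n
  define d where "d n = min_generators (G\<lparr>carrier := H n\<rparr>)" for n
  have m_pos: "m n > 0" for n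
    using rcosets_self[OF assms(4)[of n]] assms(5)[of n] by (auto simp: m_def card_gt_0_iff)
  have bound: "\<exists>C :: nat. \<forall>n. real (d n) \<le> real C + \<epsilon> * real (m n)" if "\<epsilon> > 0" for \<epsilon> :: real
  proof -
    \<comment> \<open>Cancels the factor \<open>2 * card S + 2\<close> of
      \<open>rank_bound\<close>.\<close>
    define \<eta> where "\<eta> = \<epsilon> / (2 * real (card S) + 2)"
    have \<eta>: "\<eta> > 0"
      using that by (simp add: \<eta>_def add_nonneg_pos)
    \<comment> \<open>\<open>K\<close> is fixed before \<open>n\<close>, so the constant
      \<open>K * card S\<close> is the same for the whole sequence.\<close>
    obtain K where K: "\<And>H. subgroup H G \<Longrightarrow> finite (rcosets\<^bsub>G\<^esub> H) \<Longrightarrow>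
      \<exists>\<Lambda> :: 'a set \<Rightarrow> 'a set. (\<forall>v. card {y \<in> rcosets\<^bsub>G\<^esub> H. \<Lambda> y = v} \<le> K) \<and>
        real (card {(y, s) \<in> (rcosets\<^bsub>G\<^esub> H) \<times> S. \<Lambda> y \<noteq> \<Lambda> (y #>\<^bsub>G\<^esub> s)}) \<le> \<eta> * real (card (rcosets\<^bsub>G\<^esub> H))"
      using hyperfinite[OF S(1,2) S(4) \<eta>] by blast
    have "real (d n) \<le> real (K * card S) + \<epsilon> * real (m n)" for n
    proof -
      note sub = assms(4)[of n] and fin = assms(5)[of n]
      obtain \<Lambda> :: "'a set \<Rightarrow> 'a set" where \<Lambda>: "\<And>v. card {y \<in> rcosets\<^bsub>G\<^esub> H n. \<Lambda> y = v} \<le> K"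
        "real (card {(y, s) \<in> (rcosets\<^bsub>G\<^esub> H n) \<times> S. \<Lambda> y \<noteq> \<Lambda> (y #>\<^bsub>G\<^esub> s)}) \<le> \<eta> * real (m n)"
        using K[OF sub fin] unfolding m_def by blast
      have left: "H n #>\<^bsub>G\<^esub> (h \<otimes>\<^bsub>G\<^esub> x) = H n #>\<^bsub>G\<^esub> x" if "h \<in> H n" "x \<in> carrier G" for h x
        using that sub by (metis coset_join2 coset_mult_assoc subgroup.mem_carrier subgroup.subset)
      interpret colored_cayley G \<mu> S "H n" "\<lambda>x. \<Lambda> (H n #>\<^bsub>G\<^esub> x)"
        by (intro colored_cayley.intro colored_cayley_axioms.intro mean_axioms)
          (use S sub fin left in auto)
      have "{Y \<in> rcosets\<^bsub>G\<^esub> H n. \<exists>x \<in> Y. \<Lambda> (H n #>\<^bsub>G\<^esub> x) = l} \<subseteq> {y \<in> rcosets\<^bsub>G\<^esub> H n. \<Lambda> y = l}" for l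
      proof clarify
        fix Y x assume "Y \<in> rcosets\<^bsub>G\<^esub> H n" "x \<in> Y"
        then have "H n #>\<^bsub>G\<^esub> x = Y"
          using repr_independence[OF _ _ sub] by (auto simp: RCOSETS_def)
        then show "\<Lambda> Y = \<Lambda> (H n #>\<^bsub>G\<^esub> x)"
          by simp
      qed
      then have "card {Y \<in> rcosets\<^bsub>G\<^esub> H n. \<exists>x \<in> Y. \<Lambda> (H n #>\<^bsub>G\<^esub> x) = l}
          \<le> card {y \<in> rcosets\<^bsub>G\<^esub> H n. \<Lambda> y = l}" for l
        using fin by (intro card_mono) auto
      then have "card {Y \<in> rcosets\<^bsub>G\<^esub> H n. \<exists>x \<in> Y. \<Lambda> (H n #>\<^bsub>G\<^esub> x) = l} \<le> K" for l
        using \<Lambda>(1) le_trans by blast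
      then obtain Gs where Gs: "Gs \<subseteq> H n" "finite Gs" "generate G Gs = H n"
        "card Gs \<le> K * card S + (2 * card S + 2) * card cross_edges"
        using rank_bound by blast
      have "cross_edges \<subseteq> {(y, s) \<in> (rcosets\<^bsub>G\<^esub> H n) \<times> S. \<Lambda> y \<noteq> \<Lambda> (y #>\<^bsub>G\<^esub> s)}"
        unfolding cross_edges_def
        using S(2) subgroup.subset[OF sub] by (auto simp: coset_mult_assoc subset_iff intro!: rcosetsI)
      moreover have "finite {(y, s) \<in> (rcosets\<^bsub>G\<^esub> H n) \<times> S. \<Lambda> y \<noteq> \<Lambda> (y #>\<^bsub>G\<^esub> s)}"
        by (rule finite_subset[of _ "(rcosets\<^bsub>G\<^esub> H n) \<times> S"]) (use fin S(1) in auto)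
      ultimately have "card cross_edges \<le> card {(y, s) \<in> (rcosets\<^bsub>G\<^esub> H n) \<times> S. \<Lambda> y \<noteq> \<Lambda> (y #>\<^bsub>G\<^esub> s)}"
        by (rule card_mono[rotated])
      then have "real (card cross_edges) \<le> \<eta> * real (m n)"
        using \<Lambda>(2) by linarith
      then have "(2 * real (card S) + 2) * real (card cross_edges) \<le> (2 * real (card S) + 2) * (\<eta> * real (m n))"
        by (rule mult_left_mono) simp
      also have "\<dots> = \<epsilon> * real (m n)"
        by (simp add: \<eta>_def add_nonneg_pos less_imp_neq[THEN not_sym])
      finally have "real ((2 * card S + 2) * card cross_edges) \<le> \<epsilon> * real (m n)"
        by (simp add: algebra_simps)
      moreover have "d n \<le> K * card S + (2 * card S + 2) * card cross_edges"
        using min_generators_le[OF sub Gs(1-3)] Gs(4) unfolding d_def by (rule le_trans)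
      then have "real (d n) \<le> real (K * card S) + real ((2 * card S + 2) * card cross_edges)"
        unfolding of_nat_add[symmetric] by (rule of_nat_mono)
      ultimately show ?thesis
        by linarith
    qed
    then show ?thesis
      by blast
  qed
  have "rank_gradient_seq G H \<longlonglongrightarrow> 0"
  proof (rule LIMSEQ_I)
    fix \<epsilon> :: real assume \<epsilon>: "\<epsilon> > 0"
    obtain C :: nat where C: "\<And>n. real (d n) \<le> real C + \<epsilon> / 2 * real (m n)"
      using bound[of "\<epsilon> / 2"] \<epsilon> by auto
    \<comment> \<open>An index above \<open>M\<close> makes \<open>C + 1\<close> smaller than
      \<open>\<epsilon> / 2\<close> times the index. The added 1 serves the lower bound, as
      \<open>d n - 1\<close> can be -1.\<close>
    define M where "M = nat \<lceil>2 * (real C + 1) / \<epsilon>\<rceil>"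
    have "finite (H -` {L. subgroup L G \<and> finite (rcosets\<^bsub>G\<^esub> L) \<and> card (rcosets\<^bsub>G\<^esub> L) \<le> M})"
      using finite_subgroups_of_bounded_index[OF S(1,2,4,5)] assms(6) by (rule finite_vimageI)
    moreover have "H -` {L. subgroup L G \<and> finite (rcosets\<^bsub>G\<^esub> L) \<and> card (rcosets\<^bsub>G\<^esub> L) \<le> M} = {n. m n \<le> M}"
      using assms(4,5) by (auto simp: m_def)
    ultimately have "finite {n. m n \<le> M}"
      by simp
    then obtain N where N: "\<And>n. m n \<le> M \<Longrightarrow> n < N"
      unfolding finite_nat_set_iff_bounded by blast
    show "\<exists>N. \<forall>n\<ge>N. norm (rank_gradient_seq G H n - 0) < \<epsilon>"
    proof (intro exI allI impI)
      fix n assume "n \<ge> N"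
      then have "M < m n"
        using N[of n] by fastforce
      then have "2 * (real C + 1) / \<epsilon> < real (m n)"
        unfolding M_def by linarith
      then have "real C + 1 < \<epsilon> / 2 * real (m n)"
        using \<epsilon> by (simp add: field_simps)
      then have "real (d n) - 1 < \<epsilon> * real (m n)" "- (\<epsilon> * real (m n)) < real (d n) - 1"
        using C[of n] by (auto simp: field_simps)
      then have "\<bar>real (d n) - 1\<bar> < \<epsilon> * real (m n)"
        by (simp add: abs_less_iff)
      then show "norm (rank_gradient_seq G H n - 0) < \<epsilon>"
        using m_pos[of n] by (simp add: rank_gradient_seq_def d_def m_def abs_divide divide_less_eq)
    qed
  qed
  then show ?thesis
    unfolding rank_gradient_def by (auto intro: convergentI limI)
qed

end
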